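(* There is an absolute constant $C>0$ such that for every integer $d\ge 2$, every convex lattice polytope $P\subseteq\mathbb{R}^d$ (all vertices in $\mathbb{Z}^d$) that contains no point of $\mathbb{Z}^d$ in its interior and whose vertex set is in general position has at most $C\,d^2(\log d)^3$ vertices.
   Context: A finite set of points in $\mathbb{R}^d$ is in general position if no $d+1$ of its points lie in a common hyperplane. *)

theory Defs
  imports "HOL-Analysis.Analysis"
begin

text \<open>Points of R^d are represented as functions nat => real that vanish at
  all indices >= d (coordinates 0..d-1).\<close>

definition in_Rd :: "nat \<Rightarrow> (nat \<Rightarrow> real) \<Rightarrow> bool" where
  "in_Rd d x \<longleftrightarrow> (\<forall>i\<ge>d. x i = 0)"

definition lattice_pt :: "nat \<Rightarrow> (nat \<Rightarrow> real) \<Rightarrow> bool" where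
  "lattice_pt d x \<longleftrightarrow> in_Rd d x \<and> (\<forall>i<d. x i \<in> \<int>)"

definition conv_fin :: "(nat \<Rightarrow> real) set \<Rightarrow> (nat \<Rightarrow> real) set" where
  "conv_fin V = {x. \<exists>u. (\<forall>v\<in>V. 0 \<le> u v) \<and> sum u V = 1 \<and> x = (\<lambda>i. \<Sum>v\<in>V. u v * v i)}"

definition dist_d :: "nat \<Rightarrow> (nat \<Rightarrow> real) \<Rightarrow> (nat \<Rightarrow> real) \<Rightarrow> real" where
  "dist_d d x y = sqrt (\<Sum>i<d. (x i - y i)^2)"

definition interior_d :: "nat \<Rightarrow> (nat \<Rightarrow> real) set \<Rightarrow> (nat \<Rightarrow> real) set" where
  "interior_d d S = {x. in_Rd d x \<and> (\<exists>e>0. \<forall>y. in_Rd d y \<and> dist_d d x y < e \<longrightarrow> y \<in> S)}"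

definition vertices :: "(nat \<Rightarrow> real) set \<Rightarrow> (nat \<Rightarrow> real) set" where
  "vertices P = {x. x \<in> P \<and> \<not> (\<exists>a\<in>P. \<exists>b\<in>P. a \<noteq> b \<and>
      (\<exists>t. 0 < t \<and> t < 1 \<and> x = (\<lambda>i. (1 - t) * a i + t * b i)))}"

definition hyperplane_d :: "nat \<Rightarrow> (nat \<Rightarrow> real) \<Rightarrow> real \<Rightarrow> (nat \<Rightarrow> real) set" where
  "hyperplane_d d a b = {x. in_Rd d x \<and> (\<Sum>i<d. a i * x i) = b}"

definition general_position :: "nat \<Rightarrow> (nat \<Rightarrow> real) set \<Rightarrow> bool" where
  "general_position d S \<longleftrightarrow>
     (\<forall>T\<subseteq>S. card T = d + 1 \<longrightarrow>
        \<not> (\<exists>a b. (\<exists>i<d. a i \<noteq> 0) \<and> T \<subseteq> hyperplane_d d a b))"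

end

theory Submission
  imports Defs "HOL-Probability.Probability" "HOL-Library.Function_Algebras"
begin

text \<open>
  A hollow polytope with N vertices has lattice width O(d log N). If in addition its vertices
  are lattice points in general position, they lie on O(d log N) parallel lattice hyperplanes with at most
  d vertices on each, whence N = O(d^2 log N) and so N = O(d^2 log d).

  For the width bound, choose weights c on the vertices that nearly maximise the determinant of their
  covariance form B (an approximate Loewner position). Then every vertex v, seen from the barycentre p as the
  linear functional F_v(w) = (v - p, w), satisfies F_v(w)^2 <= 5(d+1) B(w, w). Moreover a point x = p + B y
  equals the sum of c_v (1 + F_v(y)) v, so it is interior as soon as F_v(y) > -1 for all v.

  Now compare, following Banaszczyk, the Gaussian sums over Z^d for the form B and for its dual form. By Poisson
  summation a Gaussian sum is largest at the unshifted lattice, and completing the square then shows that the part of a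
  Gaussian sum lying in a half space is exponentially small. If every nonzero lattice vector w had
  |F_v(w)| large for some v, then the sum for B would be concentrated at 0, so the dual sum
  over the coset Z^d - p would be nearly as large as the one over Z^d; but only a small part of it comes from
  points with F_v(y) <= -1 for some v, so some lattice point is interior.
\<close>

subsection \<open>Poisson summation for Gaussians on the integers\<close>

text \<open>Two obstacles shape the constructions. The covariance form of weights c is not linear in
  c, since the barycentre moves with c. So the design is optimised one dimension higher, where the
  form is linear in the weights, and only then restricted to a centred copy of R^d; hence d + 1 in
  place of d. Near-maximality up to a factor 2 suffices, so no maximiser has to exist, and the price
  is the factor 5. The Gaussian comparison has one free parameter, the scale of the form. It is
  fixed so that the half spaces in both sums start at the same distance \<kappa> and a union bound
  over the N vertices loses only a small constant fraction; this is where log N comes from.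
  Determinants, inverse forms and Poisson summation in R^n are all handled by induction on n along
  the Gram-Schmidt process: a new coordinate adds one orthogonal vector, hence one factor to the
  determinant, one square to the inverse form and one use of the one-variable Poisson
  formula.\<close>

lemma periodic_eq_0_of_fourier_coeffs_0:
  fixes D :: "real \<Rightarrow> complex"
  assumes cont: "continuous_on UNIV D"
    and per: "\<And>t. D (t + 1) = D t"
    and coeff: "\<And>m::int. integral {0..1} (\<lambda>t. D t * cis (2 * pi * m * t)) = 0"
  shows "D t = 0"
proof -
  have cD: "continuous_on S D" for S
    using cont continuous_on_subset by blast
  have inner: "D x = 0" if x: "0 < x" "x < 1" for x
  proof (rule ccontr)
    assume nz: "D x \<noteq> 0"
    \<comment> \<open>\<open>p\<close> is a nonnegative trigonometric polynomial whose only maximum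
      in a period is at \<open>x\<close>. Its powers are trigonometric polynomials too, so they
      integrate to 0 against \<open>D\<close>; but they concentrate at \<open>x\<close>, which is
      incompatible with \<open>D x\<close> being nonzero.\<close>
    define p where "p t = (1 + cos (2 * pi * (t - x))) / 2" for t :: real
    have p_cis: "complex_of_real (p t) = 1/2 + cis (-2*pi*x) / 4 * cis (2*pi*t) + cis (2*pi*x) / 4 * cis (-2*pi*t)" for t
      by (auto simp: complex_eq_iff p_def cos_diff right_diff_distrib field_simps sin_diff)
    have van: "integral {0..1} (\<lambda>t. D t * cis (2 * pi * m * t) * of_real (p t) ^ n) = 0" for n and m :: int
    proof (induction n arbitrary: m)
      case (Suc n)
      let ?I = "\<lambda>m::int. (\<lambda>t. D t * cis (2 * pi * m * t) * of_real (p t) ^ n)"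
      have int: "?I m integrable_on {0..1}" for m
        unfolding p_def by (intro integrable_continuous_interval continuous_intros cD) auto
      have "D t * cis (2 * pi * m * t) * of_real (p t) ^ Suc n
         = 1/2 * ?I m t + cis (-2*pi*x) / 4 * ?I (m+1) t + cis (2*pi*x) / 4 * ?I (m-1) t" for t
      proof -
        have "cis (2 * pi * (m+1) * t) = cis (2 * pi * m * t) * cis (2*pi*t)"
          "cis (2 * pi * (m-1) * t) = cis (2 * pi * m * t) * cis (-2*pi*t)"
          by (simp_all add: cis_mult algebra_simps)
        then show ?thesis
          by (simp add: p_cis algebra_simps)
      qed
      then have "integral {0..1} (\<lambda>t. D t * cis (2 * pi * m * t) * of_real (p t) ^ Suc n)
         = integral {0..1} (\<lambda>t. 1/2 * ?I m t + cis (-2*pi*x) / 4 * ?I (m+1) t + cis (2*pi*x) / 4 * ?I (m-1) t)"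
        by presburger
      also have "\<dots> = 1/2 * integral {0..1} (?I m) + cis (-2*pi*x) / 4 * integral {0..1} (?I (m+1)) 
           + cis (2*pi*x) / 4 * integral {0..1} (?I (m-1))"
        by (intro integral_unique has_integral_add has_integral_mult_right integrable_integral int)
      also have "\<dots> = 0" by (simp add: Suc.IH del: of_int_add of_int_diff)
      finally show ?case .
    qed (use coeff in auto)
    define u where "u t = Re (D t / D x)" for t
    have cu: "continuous_on S u" for S
      unfolding u_def by (intro continuous_intros cD) (use nz in auto)
    have "u x = 1" using nz by (simp add: u_def)
    have vanu: "integral {0..1} (\<lambda>t. u t * p t ^ n) = 0" for n
    proof -
      have i1: "(\<lambda>t. D t * of_real (p t) ^ n) integrable_on {0..1}"
        unfolding p_def by (intro integrable_continuous_interval continuous_intros cD) auto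
      have "(\<lambda>t. u t * p t ^ n) = (\<lambda>t. Re (D t * of_real (p t) ^ n * inverse (D x)))"
      proof 
        fix t
        have gen: "Re (complex_of_real c * z) = c * Re z" for c z by simp
        have eq: "D t * of_real (p t) ^ n * inverse (D x) = of_real (p t ^ n) * (D t / D x)"
          by (simp add: divide_inverse)
        show "u t * p t ^ n = Re (D t * of_real (p t) ^ n * inverse (D x))"
          unfolding eq gen u_def by (rule mult.commute)
      qed
      then have "integral {0..1} (\<lambda>t. u t * p t ^ n) = Re (integral {0..1} (\<lambda>t. D t * of_real (p t) ^ n * inverse (D x)))"
        using integral_linear[OF integrable_on_mult_left[OF i1] bounded_linear_Re, of "inverse (D x)"]
        by (simp add: o_def)
      also have "\<dots> = 0"
        using van[of 0 n] by simp
      finally show ?thesis .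
    qed
    have "isCont u x" using cu[of UNIV] by (simp add: continuous_on_eq_continuous_at)
    then obtain d0 where d0: "d0 > 0" "\<And>t. \<bar>t - x\<bar> < d0 \<Longrightarrow> \<bar>u t - u x\<bar> < 1/2"
      unfolding continuous_at_eps_delta by (metis dist_real_def half_gt_zero_iff zero_less_one)
    \<comment> \<open>The halved distances to 0 and 1 keep the window inside the unit interval and
      force \<open>d\<close> < 1/2, so that the cosine is monotone on the distances compared
      below.\<close>
    define d where "d = min (d0/2) (min x (1-x) / 2)"
    have d: "d > 0" "d < d0" "d \<le> x/2" "d \<le> (1-x)/2" using x d0 by (auto simp: d_def min_def)
    have near: "u t \<ge> 1/2" if "\<bar>t - x\<bar> \<le> d" for t
      using d0(2)[of t] that d \<open>u x = 1\<close> by (smt (verit) field_sum_of_halves)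
    obtain M where M: "M > 0" "\<And>t. t \<in> {0..1} \<Longrightarrow> \<bar>u t\<bar> \<le> M"
    proof -
      have "compact (u ` {0..1})" by (intro compact_continuous_image cu) auto
      then obtain M where "\<forall>y\<in>u ` {0..1}. norm y \<le> M"
        using compact_imp_bounded bounded_iff by blast
      then have "\<And>t. t \<in> {0..1} \<Longrightarrow> \<bar>u t\<bar> \<le> max M 1" by (metis image_eqI max.coboundedI1 real_norm_def)
      then show ?thesis using that[of "max M 1"] by simp
    qed
    define r q where "r = (1 + cos (2*pi*(d/2))) / 2" and "q = (1 + cos (2*pi*d)) / 2"
    have "d < 1/2" using d x by auto
    have half: "0 \<le> (1 + c) / 2" if "-1 \<le> c" for c :: real using that by simp
    have qr: "0 \<le> q" "q < r"
    proof -
      show "0 \<le> q" unfolding q_def by (rule half[OF cos_ge_minus_one])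
      have "cos (2*pi*d) < cos (2*pi*(d/2))"
        using d \<open>d<1/2\<close> by (intro cos_monotone_0_pi) (auto simp: field_simps)
      then show "q < r" by (simp add: q_def r_def)
    qed
    have p01: "0 \<le> p t" for t unfolding p_def by (rule half[OF cos_ge_minus_one])
    have p_abs: "p t = (1 + cos (2*pi*\<bar>t-x\<bar>))/2" for t by (simp add: p_def abs_if) (metis cos_minus minus_diff_eq mult_minus_right)
    have p_near: "r \<le> p t" if "\<bar>t-x\<bar> \<le> d/2" for t
    proof -
      have "cos (2*pi*(d/2)) \<le> cos (2*pi*\<bar>t-x\<bar>)"
        using d \<open>d<1/2\<close> that by (intro cos_monotone_0_pi_le mult_left_mono) (auto simp: field_simps)
      then show ?thesis by (simp add: p_abs r_def)
    qed
    have p_far: "p t \<le> q" if "\<bar>t-x\<bar> \<ge> d" "t \<in> {0..1}" for t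
    proof (cases "\<bar>t-x\<bar> \<le> 1/2")
      case True
      then have "cos (2*pi*\<bar>t-x\<bar>) \<le> cos (2*pi*d)"
        using d that by (intro cos_monotone_0_pi_le mult_left_mono) (auto simp: field_simps)
      then show ?thesis by (simp add: p_abs q_def)
    next
      case False
      \<comment> \<open>Beyond half a period the distance to \<open>x\<close> is measured the other
        way round the circle.\<close>
      have "cos (2*pi*\<bar>t-x\<bar>) = cos (2*pi - 2*pi*\<bar>t-x\<bar>)" by (simp add: cos_diff)
      also have "\<dots> = cos (2*pi*(1 - \<bar>t-x\<bar>))" by (simp add: algebra_simps)
      also have "\<dots> \<le> cos (2*pi*d)"
      proof (intro cos_monotone_0_pi_le)
        have "\<bar>t-x\<bar> \<le> 1 - d" using that d by auto
        then show "2*pi*d \<le> 2*pi*(1-\<bar>t-x\<bar>)" by (intro mult_left_mono) auto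
        show "2*pi*(1-\<bar>t-x\<bar>) \<le> pi" using False by (simp add: field_simps)
      qed (use d in auto)
      finally show ?thesis by (simp add: p_abs q_def)
    qed
    \<comment> \<open>Three zones: on the inner half of the window the integrand is at least r^n /
      2, on the rest of the window it is nonnegative, outside it is at least - M q^n. As the
      integral is 0, the powers of q / r < 1 would stay away from 0.\<close>
    have ineq: "d/2 * r^n \<le> M * q^n" for n
    proof -
      let ?i = "indicator {x-d/2..x+d/2} :: real \<Rightarrow> real"
      have sub: "{x-d/2..x+d/2} \<subseteq> {0..1}" using d x by auto
      have hi: "((\<lambda>t. ?i t *\<^sub>R (r^n/2)) has_integral (d * (r^n/2))) {0..1}"
      proof -
        have "((\<lambda>t. r^n/2) has_integral (d * (r^n/2))) {x-d/2..x+d/2}"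
          using has_integral_const_real[of "r^n/2" "x-d/2" "x+d/2"] d by simp
        then have "((\<lambda>t. if t \<in> {x-d/2..x+d/2} then r^n/2 else 0) has_integral (d * (r^n/2))) {0..1}"
          using sub by (subst has_integral_restrict) auto
        then show ?thesis by (rule has_integral_eq[rotated]) (auto simp: indicator_def)
      qed
      have "d * (r^n/2) - M * q^n \<le> integral {0..1} (\<lambda>t. u t * p t ^ n)"
      proof (rule has_integral_le)
        show "((\<lambda>t. ?i t *\<^sub>R (r^n/2) - M * q^n) has_integral (d * (r^n/2) - M*q^n)) {0..1}"
          using has_integral_diff[OF hi has_integral_const_real[of "M*q^n" 0 1]] by simp
        show "((\<lambda>t. u t * p t ^ n) has_integral integral {0..1} (\<lambda>t. u t * p t ^ n)) {0..1}"
          unfolding p_def by (intro integrable_integral integrable_continuous_interval continuous_intros cu) auto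
        fix t :: real assume t: "t \<in> {0..1}"
        have Mq: "0 \<le> M * q^n" using M qr by simp
        consider "\<bar>t-x\<bar> \<le> d/2" | "d/2 < \<bar>t-x\<bar>" "\<bar>t-x\<bar> \<le> d" | "\<bar>t-x\<bar> > d" by linarith
        then show "?i t *\<^sub>R (r^n/2) - M * q^n \<le> u t * p t ^ n"
        proof cases
          case 1
          have "1/2 * r^n \<le> u t * p t ^ n"
            using near[of t] p_near[OF 1] 1 d qr by (intro mult_mono power_mono) auto
          moreover have "?i t *\<^sub>R (r^n/2) \<le> 1/2 * r^n" using qr by (auto simp: indicator_def)
          ultimately show ?thesis using Mq by linarith
        next
          case 2
          then have "?i t = 0" by (auto simp: indicator_def abs_if split: if_splits)
          moreover have "0 \<le> u t * p t ^ n" using near[of t] 2 p01 by simp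
          ultimately show ?thesis using Mq by simp
        next
          case 3
          then have "?i t = 0" using d by (auto simp: indicator_def)
          moreover have "\<bar>u t * p t ^ n\<bar> \<le> M * q ^ n" 
            unfolding abs_mult using p_far[of t] 3 t p01 M
            by (intro mult_mono) (auto intro!: power_mono)
          ultimately show ?thesis by simp
        qed
      qed
      then show ?thesis using vanu[of n] by simp
    qed
    have "(\<lambda>n. (q/r)^n) \<longlonglongrightarrow> 0" using qr by (intro LIMSEQ_power_zero) (auto simp: abs_of_nonneg)
    then have "(\<lambda>n. M * (q/r)^n) \<longlonglongrightarrow> M * 0" by (rule tendsto_mult_left)
    moreover have "\<forall>n. d/2 \<le> M * (q/r)^n"
      using ineq qr by (simp add: power_divide field_simps)
    ultimately have "d/2 \<le> M * 0" by (intro LIMSEQ_le_const) auto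
    then show False using d by simp
  qed
  have perint: "D (s + of_int k) = D s" for s k
  proof -
    have nat: "D (s + of_nat n) = D s" for s n
    proof (induction n)
      case (Suc n)
      then show ?case using per[of "s + of_nat n"] by (simp add: ac_simps)
    qed simp
    show ?thesis
    proof (cases "k \<ge> 0")
      case True then show ?thesis using nat[of s "nat k"] by simp
    next
      case False then show ?thesis using nat[of "s + of_int k" "nat (-k)"] by simp
    qed
  qed
  have non_int: "D s = 0" if "s \<notin> \<int>" for s
    using inner[of "frac s"] perint[of s "-\<lfloor>s\<rfloor>"] that frac_lt_1[of s] frac_gt_0_iff[of s]
    by (simp add: frac_def)
  show ?thesis
  proof (cases "t \<in> \<int>")
    \<comment> \<open>Integers are reached by continuity, along t + 1 / (n + 2); starting with 1/2
      keeps these points off the integers.\<close>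
    case True
    have "(\<lambda>n. D (t + inverse (real (Suc (Suc n))))) \<longlonglongrightarrow> D (t + 0)"
      using cont by (intro isCont_tendsto_compose[of _ D] tendsto_intros LIMSEQ_Suc[OF LIMSEQ_inverse_real_of_nat])
        (simp add: continuous_on_eq_continuous_at)
    moreover have "D (t + inverse (real (Suc (Suc n)))) = 0" for n
    proof (rule non_int)
      show "t + inverse (real (Suc (Suc n))) \<notin> \<int>"
      proof
        assume "t + inverse (real (Suc (Suc n))) \<in> \<int>"
        then have "inverse (real (Suc (Suc n))) \<in> \<int>" using True by (metis Ints_diff add_diff_cancel_left')
        then have "inverse (real (Suc (Suc n))) \<ge> 1" 
          by (metis Ints_nonzero_abs_ge1 abs_of_nonneg inverse_nonnegative_iff_nonnegative nonzero_imp_inverse_nonzero of_nat_0_le_iff of_nat_eq_0_iff nat.distinct(1))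
        then show False by (simp add: field_simps)
      qed
    qed
    ultimately show ?thesis by (simp add: LIMSEQ_const_iff)
  qed (rule non_int)
qed

section \<open>Gaussian sums over the integers: majorants, continuity, termwise integration\<close>

lemma summable_exp_neg_abs_int:
  fixes b :: real
  assumes "b > 0"
  shows "(\<lambda>k::int. exp (- b * \<bar>real_of_int k\<bar>)) summable_on UNIV"
proof -
  have s: "(\<lambda>n::nat. exp (- b * real n)) summable_on UNIV"
  proof (rule summable_nonneg_imp_summable_on)
    have "(\<lambda>n::nat. exp (- b) ^ n) = (\<lambda>n. exp (- b * real n))"
      by (simp add: exp_of_nat_mult[symmetric] mult.commute)
    then show "summable (\<lambda>n::nat. exp (- b * real n))"
      using summable_geometric[of "exp (-b)"] assms by simp
  qed auto
  have "(\<lambda>k::int. exp (- b * \<bar>real_of_int k\<bar>)) summable_on (range int \<union> range (\<lambda>n. - int (Suc n)))"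
  proof (rule summable_on_Un_disjoint)
    show "(\<lambda>k::int. exp (- b * \<bar>real_of_int k\<bar>)) summable_on range int"
      using s by (subst summable_on_reindex) (auto simp: o_def)
    have "(\<lambda>n::nat. exp (- b) * exp (- b * real n)) summable_on UNIV"
      using s by (rule summable_on_cmult_right)
    then show "(\<lambda>k::int. exp (- b * \<bar>real_of_int k\<bar>)) summable_on range (\<lambda>n. - int (Suc n))"
      by (subst summable_on_reindex) (auto simp: o_def inj_on_def exp_add[symmetric] algebra_simps)
  qed auto
  moreover have "range int \<union> range (\<lambda>n. - int (Suc n)) = UNIV"
  proof -
    have "k \<in> range int \<union> range (\<lambda>n. - int (Suc n))" for k :: int
      by (cases k) auto
    then show ?thesis by auto
  qed
  ultimately show ?thesis by simp
qed

text \<open>Rests on |k| \<le> k^2 \<le> 2 (k + t)^2 + 2 t^2 for integers k. The resulting geometric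
  majorant is uniform for t in a bounded interval, as the M-test for the periodised Gaussian
  requires.\<close>

lemma exp_neg_square_shift_le:
  fixes a t R :: real and k :: int
  assumes "a > 0" "\<bar>t\<bar> \<le> R"
  shows "exp (- a * (k + t)\<^sup>2) \<le> exp (a * R\<^sup>2) * exp (- (a/2) * \<bar>real_of_int k\<bar>)"
proof -
  have "\<bar>real_of_int k\<bar> \<le> (real_of_int k)\<^sup>2"
    using int_one_le_iff_zero_less[of "\<bar>k\<bar>"] self_le_power[of "\<bar>real_of_int k\<bar>" 2]
    by (cases "k = 0") auto
  also have "\<dots> \<le> 2 * (k + t)\<^sup>2 + 2 * t\<^sup>2"
    using zero_le_power2[of "k + 2 * t"] by (simp add: power2_eq_square algebra_simps)
  also have "t\<^sup>2 \<le> R\<^sup>2" using assms(2) abs_le_square_iff[of t R] by simp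
  finally have "\<bar>real_of_int k\<bar> / 2 - R\<^sup>2 \<le> (k + t)\<^sup>2" by simp
  then have "a * (\<bar>real_of_int k\<bar> / 2 - R\<^sup>2) \<le> a * (k + t)\<^sup>2"
    using assms by (intro mult_left_mono) auto
  then show ?thesis by (simp add: exp_add[symmetric] algebra_simps)
qed

lemma summable_gaussian_int:
  fixes a t :: real
  assumes "a > 0"
  shows "(\<lambda>k::int. exp (- a * (k + t)\<^sup>2)) summable_on UNIV"
  by (rule summable_on_comparison_test[OF summable_on_cmult_right[OF summable_exp_neg_abs_int[of "a/2"]]])
    (use assms exp_neg_square_shift_le[OF assms order_refl] in auto)

text \<open>An integer shift permutes the terms, so only the fractional part of t matters.
  Uniformity in t is what allows a coordinate to be summed out when its shift depends on the other
  coordinates.\<close>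

lemma infsum_gaussian_int_bounded:
  fixes a :: real
  assumes "a > 0"
  shows "\<exists>K. \<forall>t. (\<Sum>\<^sub>\<infinity>k::int. exp (- a * (k + t)\<^sup>2)) \<le> K"
proof (intro exI allI)
  fix t :: real
  have "(\<Sum>\<^sub>\<infinity>k::int. exp (- a * (k + t)\<^sup>2)) = (\<Sum>\<^sub>\<infinity>k::int. exp (- a * (k + frac t)\<^sup>2))"
    by (rule infsum_reindex_bij_witness[of _ "\<lambda>k. k - \<lfloor>t\<rfloor>" "\<lambda>k. k + \<lfloor>t\<rfloor>"])
      (auto simp: frac_def algebra_simps)
  also have "\<dots> \<le> (\<Sum>\<^sub>\<infinity>k::int. exp (a * 1\<^sup>2) * exp (- (a/2) * \<bar>real_of_int k\<bar>))"
    using assms exp_neg_square_shift_le[OF assms, of "frac t" 1] frac_ge_0[of t] frac_lt_1[of t]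
    by (intro infsum_mono summable_gaussian_int summable_on_cmult_right summable_exp_neg_abs_int) auto
  finally show "(\<Sum>\<^sub>\<infinity>k::int. exp (- a * (k + t)\<^sup>2)) \<le> \<dots>" .
qed

lemma continuous_on_infsum_M_test:
  fixes f :: "'a \<Rightarrow> real \<Rightarrow> complex"
  assumes "\<And>k. continuous_on A (f k)" "\<And>k t. t \<in> A \<Longrightarrow> norm (f k t) \<le> M k" "M summable_on UNIV"
  shows "continuous_on A (\<lambda>t. \<Sum>\<^sub>\<infinity>k. f k t)"
  by (rule uniform_limit_theorem[OF _ Weierstrass_m_test_general[of UNIV A f M]])
    (use assms in \<open>auto intro!: continuous_intros\<close>)

lemma has_sum_integral_M_test:
  fixes f :: "'a \<Rightarrow> real \<Rightarrow> complex"
  assumes "\<And>k. continuous_on {a..b} (f k)" "\<And>k t. t \<in> {a..b} \<Longrightarrow> norm (f k t) \<le> M k" "M summable_on UNIV"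
  shows "((\<lambda>k. integral {a..b} (f k)) has_sum integral {a..b} (\<lambda>t. \<Sum>\<^sub>\<infinity>k. f k t)) UNIV"
proof -
  have "uniform_limit {a..b} (\<lambda>X t. \<Sum>k\<in>X. f k t) (\<lambda>t. \<Sum>\<^sub>\<infinity>k. f k t) (finite_subsets_at_top UNIV)"
    using assms by (intro Weierstrass_m_test_general[of UNIV _ f M]) auto
  then obtain I J where IJ: "\<And>X. ((\<lambda>t. \<Sum>k\<in>X. f k t) has_integral I X) {a..b}"
      "((\<lambda>t. \<Sum>\<^sub>\<infinity>k. f k t) has_integral J) {a..b}" "(I \<longlongrightarrow> J) (finite_subsets_at_top UNIV)"
    by (rule uniform_limit_integral) (use assms in \<open>auto intro!: continuous_intros\<close>)
  have "I X = (\<Sum>k\<in>X. integral {a..b} (f k))" if "finite X" for X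
  proof -
    have "((\<lambda>t. \<Sum>k\<in>X. f k t) has_integral (\<Sum>k\<in>X. integral {a..b} (f k))) {a..b}"
      using assms that by (intro has_integral_sum integrable_integral integrable_continuous_interval) auto
    then show ?thesis using IJ(1)[of X] has_integral_unique by blast
  qed
  then have "eventually (\<lambda>X. I X = (\<Sum>k\<in>X. integral {a..b} (f k))) (finite_subsets_at_top UNIV)"
    by (intro eventually_finite_subsets_at_top_weakI) auto
  then have "((\<lambda>X. \<Sum>k\<in>X. integral {a..b} (f k)) \<longlongrightarrow> J) (finite_subsets_at_top UNIV)"
    using IJ(3) by (simp add: filterlim_cong)
  moreover have "J = integral {a..b} (\<lambda>t. \<Sum>\<^sub>\<infinity>k. f k t)" using IJ(2) by (simp add: integral_unique)
  ultimately show ?thesis by (simp add: has_sum_def)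
qed

section \<open>The one-variable Poisson formula\<close>

lemma fourier_transform_gaussian:
  fixes a \<xi> :: real
  assumes "a > 0"
  shows "integrable lborel (\<lambda>x. of_real (exp (- pi * a * x\<^sup>2)) * cis (2 * pi * \<xi> * x))"
    and "(LINT x|lborel. of_real (exp (- pi * a * x\<^sup>2)) * cis (2 * pi * \<xi> * x))
      = of_real (exp (- pi * \<xi>\<^sup>2 / a) / sqrt a)"
proof -
  \<comment> \<open>The substitution x -> c x turns the standard normal density into a multiple of
    exp (- pi a x^2), so the transform is the characteristic function of the normal distribution at
    \<open>t\<close>.\<close>
  define c where "c = sqrt (2 * pi * a)"
  have c: "c > 0" "c\<^sup>2 = 2 * pi * a" using assms by (auto simp: c_def)
  define t where "t = 2 * pi * \<xi> / c"
  let ?f = "\<lambda>x. std_normal_density x *\<^sub>R iexp (t * x)"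
  have dens: "std_normal_density (c * x) = exp (- pi * a * x\<^sup>2) / sqrt (2 * pi)" for x
    by (simp add: std_normal_density_def power_mult_distrib c)
  have iex: "iexp (t * (c * x)) = cis (2 * pi * \<xi> * x)" for x
    using c by (simp add: t_def cis_conv_exp mult.assoc)
  have fx: "?f (0 + c * x) = complex_of_real (1 / sqrt (2 * pi)) * (of_real (exp (- pi * a * x\<^sup>2)) * cis (2 * pi * \<xi> * x))" for x
    using iex[of x] dens[of x] by (simp add: scaleR_conv_of_real)
  have int: "integrable lborel ?f"
  proof (rule Bochner_Integration.integrable_bound)
    show "integrable lborel std_normal_density" by simp
  qed (auto simp: normal_density_nonneg)
  have "integrable lborel (\<lambda>x. ?f (0 + c * x))"
    using int c by (subst lborel_integrable_real_affine_iff) auto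
  then have "integrable lborel (\<lambda>x. of_real (sqrt (2 * pi)) * ?f (0 + c * x))"
    by (rule integrable_mult_right)
  then show "integrable lborel (\<lambda>x. of_real (exp (- pi * a * x\<^sup>2)) * cis (2 * pi * \<xi> * x))"
    unfolding fx by simp
  have "of_real (exp (- (t^2) / 2)) = char std_normal_distribution t"
    by (simp add: char_std_normal_distribution)
  also have "\<dots> = (LINT x|lborel. ?f x)"
    unfolding char_def by (subst integral_density) (auto simp: normal_density_nonneg)
  also have "\<dots> = c *\<^sub>R (LINT x|lborel. ?f (0 + c * x))"
    using c by (subst lborel_integral_real_affine[where c = c and t = 0]) auto
  also have "\<dots> = of_real (c / sqrt (2 * pi)) * (LINT x|lborel. of_real (exp (- pi * a * x\<^sup>2)) * cis (2 * pi * \<xi> * x))"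
    unfolding fx by (simp add: scaleR_conv_of_real)
  also have "c / sqrt (2 * pi) = sqrt a"
    by (simp add: c_def real_sqrt_mult)
  also have "- (t\<^sup>2) / 2 = - pi * \<xi>\<^sup>2 / a"
    using assms unfolding t_def power_divide c(2) power_mult_distrib by (simp add: field_simps power2_eq_square)
  finally show "(LINT x|lborel. of_real (exp (- pi * a * x\<^sup>2)) * cis (2 * pi * \<xi> * x))
      = of_real (exp (- pi * \<xi>\<^sup>2 / a) / sqrt a)"
    using assms by (simp add: field_simps)
qed

text \<open>The range is half-open because the unit intervals [k, k + 1] over these k tile [- n, n];
  an unconditional sum over the integers thus becomes a limit of integrals over [- n, n].\<close>

lemma filterlim_symmetric_int_intervals:
  "filterlim (\<lambda>n::nat. {- int n..<int n}) (finite_subsets_at_top UNIV) sequentially"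
  unfolding filterlim_finite_subsets_at_top
proof (intro allI impI)
  fix X :: "int set" assume X: "finite X \<and> X \<subseteq> UNIV"
  obtain N where N: "\<And>k. k \<in> X \<Longrightarrow> \<bar>k\<bar> < int N"
  proof (cases "X = {}")
    case False
    have "\<bar>k\<bar> < int (Suc (nat (Max (abs ` X))))" if "k \<in> X" for k
    proof -
      have "\<bar>k\<bar> \<le> Max (abs ` X)" using X that by (intro Max_ge) auto
      then show ?thesis by linarith
    qed
    then show ?thesis using that by blast
  qed (use that in auto)
  have "X \<subseteq> {- int n..<int n}" if "n \<ge> N" for n
    using N that by fastforce
  then show "\<forall>\<^sub>F n in sequentially. finite {- int n..<int n} \<and> X \<subseteq> {- int n..<int n} \<and> {- int n..<int n} \<subseteq> UNIV"
    by (intro eventually_sequentiallyI[of N]) auto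
qed

lemma sum_integral_unit_intervals:
  fixes g :: "real \<Rightarrow> complex"
  assumes "continuous_on UNIV g"
  shows "(\<Sum>k\<in>{- int n..<int n}. integral {0..1} (\<lambda>t. g (k + t))) = integral {- real n..real n} g"
proof -
  have int: "g integrable_on {a..b}" for a b
    using assms by (intro integrable_continuous_interval continuous_on_subset[OF assms]) auto
  have shift: "integral {0..1} (\<lambda>t. g (real_of_int k + t)) = integral {real_of_int k..k+1} g" for k
  proof -
    have "(g has_integral integral {real_of_int k..k+1} g) (cbox (real_of_int k) (k+1))"
      using int by (simp add: integrable_integral)
    then have "((\<lambda>x. g (1 *\<^sub>R x + real_of_int k)) has_integral (integral {real_of_int k..k+1} g /\<^sub>R \<bar>1\<bar> ^ DIM(real)))
       ((\<lambda>x. (1/1) *\<^sub>R x + - ((1/1) *\<^sub>R real_of_int k)) ` cbox (real_of_int k) (k+1))"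
      using has_integral_affinity[of g "integral {real_of_int k..k+1} g" "real_of_int k" "real_of_int (k+1)" 1 "real_of_int k"] by simp
    moreover have "(\<lambda>x. (1/1) *\<^sub>R x + - ((1/1) *\<^sub>R real_of_int k)) ` cbox (real_of_int k) (k+1) = {0..1}"
      by (auto simp: image_iff intro!: bexI[of _ "_ + real_of_int k"])
    ultimately show ?thesis by (auto intro!: integral_unique simp: add.commute)
  qed
  show ?thesis
  proof (induction n)
    case (Suc n)
    have "{- int (Suc n)..<int (Suc n)} = insert (- int n - 1) (insert (int n) {- int n..<int n})" by auto
    then have "(\<Sum>k\<in>{- int (Suc n)..<int (Suc n)}. integral {0..1} (\<lambda>t. g (k + t)))
       = integral {- real n - 1..- real n} g + (integral {real n..real n + 1} g + integral {- real n..real n} g)"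
      by (simp add: Suc.IH[symmetric] shift)
    also have "\<dots> = integral {- real n - 1..- real n} g + integral {- real n..real n + 1} g"
      using Henstock_Kurzweil_Integration.integral_combine[of "- real n" "real n" "real n + 1" g] int by (simp add: add.commute)
    also have "\<dots> = integral {- real n - 1..real n + 1} g"
      using Henstock_Kurzweil_Integration.integral_combine[of "- real n - 1" "- real n" "real n + 1" g] int by (simp add: add.commute)
    also have "{- real n - 1..real n + 1} = {- real (Suc n)..real (Suc n)}" by auto
    finally show ?case .
  qed simp
qed

lemma integral_symmetric_intervals_LIMSEQ:
  fixes g :: "real \<Rightarrow> complex"
  assumes "continuous_on UNIV g" "integrable lborel g"
  shows "(\<lambda>n. integral {- real n..real n} g) \<longlonglongrightarrow> (LINT x|lborel. g x)"
proof -
  have "integral {- real n..real n} g = (LINT x|lborel. indicator {- real n..real n} x *\<^sub>R g x)" for n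
    using set_borel_integral_eq_integral(2)[of "{- real n..real n}" g] assms(2)
    by (simp add: set_lebesgue_integral_def set_integrable_def integrable_mult_indicator)
  moreover have "(\<lambda>n. LINT x|lborel. indicator {- real n..real n} x *\<^sub>R g x) \<longlonglongrightarrow> (LINT x|lborel. g x)"
  proof (rule integral_dominated_convergence[where w = "\<lambda>x. norm (g x)"])
    show "AE x in lborel. (\<lambda>n. indicator {- real n..real n} x *\<^sub>R g x) \<longlonglongrightarrow> g x"
    proof (rule AE_I2)
      fix x :: real
      obtain N where N: "\<bar>x\<bar> \<le> real N" using real_arch_simple by blast
      have "\<forall>\<^sub>F n in sequentially. indicator {- real n..real n} x *\<^sub>R g x = g x"
      proof (rule eventually_sequentiallyI[of N])
        fix n assume "N \<le> n"
        then have "real N \<le> real n" by simp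
        then have "x \<in> {- real n..real n}" using N by auto
        then show "indicator {- real n..real n} x *\<^sub>R g x = g x" by simp
      qed
      then show "(\<lambda>n. indicator {- real n..real n} x *\<^sub>R g x) \<longlonglongrightarrow> g x"
        by (rule tendsto_eventually)
    qed
  qed (use assms in \<open>auto simp: indicator_def\<close>)
  ultimately show ?thesis by simp
qed

text \<open>\<open>G\<close> periodises the modulated Gaussian, and \<open>H\<close> is the Fourier
  series whose coefficients are the Gaussian transforms. Both are continuous of period 1 with equal
  Fourier coefficients, so they coincide. Shift \<open>t\<close> and frequency \<open>y\<close> are
  both kept because the induction on the dimension meets both at once, with a shift depending on the
  other coordinates.\<close>

lemma poisson_summation_gaussian_int:
  fixes a t y :: real
  assumes a: "a > 0"
  shows "(\<Sum>\<^sub>\<infinity>k::int. of_real (exp (- pi * a * (k + t)\<^sup>2)) * cis (2 * pi * y * k))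
    = of_real (1 / sqrt a) * (\<Sum>\<^sub>\<infinity>m::int. of_real (exp (- pi * (m - y)\<^sup>2 / a)) * cis (2 * pi * (m - y) * t))"
proof -
  define g where "g x = complex_of_real (exp (- pi * a * x\<^sup>2)) * cis (2 * pi * y * x)" for x
  define b where "b m = complex_of_real (exp (- pi * (m - y)\<^sup>2 / a) / sqrt a)" for m :: int
  define G where "G s = (\<Sum>\<^sub>\<infinity>k::int. g (k + s))" for s :: real
  define H where "H s = (\<Sum>\<^sub>\<infinity>m::int. b m * cis (2 * pi * m * s))" for s :: real
  define M where "M R k = exp (pi * a * R\<^sup>2) * exp (- (pi * a/2) * \<bar>real_of_int k\<bar>)" for R :: real and k :: int
  have pa: "pi * a > 0" using a by simp
  have Msum: "M R summable_on UNIV" for R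
    unfolding M_def using summable_exp_neg_abs_int[of "pi*a/2"] a by (intro summable_on_cmult_right) auto
  have gM: "norm (g (k + s)) \<le> M R k" if "\<bar>s\<bar> \<le> R" for k :: int and s R :: real
    using exp_neg_square_shift_le[OF pa that, of k] by (simp add: g_def M_def norm_mult)
  have cg: "continuous_on A g" for A unfolding g_def by (intro continuous_intros)
  have cgk: "continuous_on A (\<lambda>s. g (real_of_int k + s))" for A k
    unfolding g_def by (intro continuous_intros)
  have bsum: "(\<lambda>m. norm (b m)) summable_on UNIV"
  proof -
    have "(\<lambda>m::int. exp (- (pi / a) * (m + - y)\<^sup>2) * (1 / sqrt a)) summable_on UNIV"
      using a by (intro summable_on_cmult_left summable_gaussian_int) auto
    then show ?thesis using a by (simp add: b_def norm_divide)
  qed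
  have cG: "continuous_on UNIV G"
  proof -
    have "continuous_on {-R<..<R} G" for R
      unfolding G_def by (rule continuous_on_infsum_M_test[OF cgk _ Msum[of R]]) (auto intro!: gM)
    then have "isCont G s" for s
    proof -
      have "s \<in> {-(\<bar>s\<bar>+1)<..<\<bar>s\<bar>+1}" by auto
      then show ?thesis
        using \<open>\<And>R. continuous_on {-R<..<R} G\<close>[of "\<bar>s\<bar>+1"] continuous_on_eq_continuous_at[OF open_greaterThanLessThan] by blast
    qed
    then show ?thesis by (simp add: continuous_at_imp_continuous_on)
  qed
  have cH: "continuous_on UNIV H"
    unfolding H_def by (rule continuous_on_infsum_M_test[OF _ _ bsum]) (auto simp: norm_mult intro!: continuous_intros)
  have perG: "G (s + 1) = G s" for s
    unfolding G_def
    by (rule infsum_reindex_bij_witness[of _ "\<lambda>k. k - 1" "\<lambda>k. k + 1"]) (auto simp: algebra_simps)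
  have perH: "H (s + 1) = H s" for s
  proof -
    have "cis (2 * pi * m * (s + 1)) = cis (2 * pi * m * s)" for m :: int
    proof -
      have "cis (2 * pi * m * (s + 1)) = cis (2 * pi * m * s) * cis (2 * pi * m)"
        by (simp add: cis_mult algebra_simps)
      also have "cis (2 * pi * m) = 1" by (rule cis_multiple_2pi) auto
      finally show ?thesis by simp
    qed
    then show ?thesis by (simp add: H_def)
  qed
  \<comment> \<open>Unfolding: the character of index j does not see integer translations, so the
    integrals over unit intervals combine to a Fourier integral over the line. The pairing uses
    \<open>cis\<close> with a plus sign, hence the index - j.\<close>
  have Gcoeff: "integral {0..1} (\<lambda>s. G s * cis (2 * pi * j * s)) = b (- j)" for j :: int
  proof -
    define gj where "gj x = complex_of_real (exp (- pi * a * x\<^sup>2)) * cis (2 * pi * (y + j) * x)" for x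
    have gj: "gj (k + s) = g (k + s) * cis (2 * pi * j * s)" for k :: int and s :: real
    proof -
      have "cis (2 * pi * (y + j) * (k + s)) = cis (2 * pi * y * (k + s)) * cis (2 * pi * j * s) * cis (2 * pi * (j * k))"
        by (simp add: cis_mult algebra_simps)
      also have "cis (2 * pi * (j * k)) = 1"
        by (rule cis_multiple_2pi) auto
      finally show ?thesis by (simp add: gj_def g_def)
    qed
    have cgj: "continuous_on A gj" for A unfolding gj_def by (intro continuous_intros)
    have "((\<lambda>k::int. integral {0..1} (\<lambda>s. g (k + s) * cis (2 * pi * j * s))) has_sum
        integral {0..1} (\<lambda>s. \<Sum>\<^sub>\<infinity>k::int. g (k + s) * cis (2 * pi * j * s))) UNIV"
      by (rule has_sum_integral_M_test[OF _ _ Msum[of 1]])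
        (auto intro!: continuous_intros cgk gM simp: norm_mult)
    then have "((\<lambda>k::int. integral {0..1} (\<lambda>s. gj (k + s))) has_sum
        integral {0..1} (\<lambda>s. G s * cis (2 * pi * j * s))) UNIV"
      unfolding gj G_def infsum_cmult_left' .
    then have "(\<lambda>n. \<Sum>k\<in>{- int n..<int n}. integral {0..1} (\<lambda>s. gj (k + s))) \<longlonglongrightarrow> 
        integral {0..1} (\<lambda>s. G s * cis (2 * pi * j * s))"
      unfolding has_sum_def by (rule filterlim_compose[OF _ filterlim_symmetric_int_intervals])
    moreover have "(\<lambda>n. \<Sum>k\<in>{- int n..<int n}. integral {0..1} (\<lambda>s. gj (k + s))) \<longlonglongrightarrow> b (- j)"
    proof -
      have "(LINT x|lborel. gj x) = b (- j)"
        using fourier_transform_gaussian(2)[OF a, of "y + j"] by (simp add: gj_def b_def power2_eq_square algebra_simps)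
      moreover have "integrable lborel gj" unfolding gj_def by (rule fourier_transform_gaussian(1)[OF a])
      ultimately show ?thesis
        using integral_symmetric_intervals_LIMSEQ[OF cgj] by (simp add: sum_integral_unit_intervals[OF cgj])
    qed
    ultimately show ?thesis by (rule LIMSEQ_unique)
  qed
  have Hcoeff: "integral {0..1} (\<lambda>s. H s * cis (2 * pi * j * s)) = b (- j)" for j :: int
  proof -
    have ch: "integral {0..1} (\<lambda>s. b m * cis (2 * pi * m * s) * cis (2 * pi * j * s)) = (if m = - j then b m else 0)" for m :: int
    proof -
      have eq: "b m * cis (2 * pi * m * s) * cis (2 * pi * j * s) = b m * cis (2 * pi * (m + j) * s)" for s
        by (simp add: cis_mult algebra_simps)
      show ?thesis
      proof (cases "m = - j")
        case False
        define w where "w = 2 * pi * (m + j)"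
        have "w \<noteq> 0" using False unfolding w_def by (simp add: add_eq_0_iff2 of_int_add[symmetric] del: of_int_add)
        have "((\<lambda>s. cis (w * s)) has_integral (cis (w * 1) / (\<i> * w) - cis (w * 0) / (\<i> * w))) {0..1}"
        proof (rule fundamental_theorem_of_calculus)
          show "((\<lambda>s. cis (w * s) / (\<i> * w)) has_vector_derivative cis (w * s)) (at s within {0..1})" for s
            using \<open>w \<noteq> 0\<close> unfolding cis_conv_exp
            by (auto intro!: derivative_eq_intros has_vector_derivative_real_field simp: field_simps)
        qed simp
        moreover have "cis (w * 1) = 1" unfolding w_def using cis_multiple_2pi[of "m + j"] by simp
        ultimately have "((\<lambda>s. cis (w * s)) has_integral 0) {0..1}" by simp
        then have "((\<lambda>s. b m * cis (w * s)) has_integral b m * 0) {0..1}" by (rule has_integral_mult_right)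
        then have "integral {0..1} (\<lambda>s. b m * cis (w * s)) = b m * 0" by (rule integral_unique)
        then show ?thesis unfolding eq w_def using False by (simp only: if_False mult_zero_right)
      next
        case True
        then show ?thesis unfolding eq by simp
      qed
    qed
    have "((\<lambda>m. integral {0..1} (\<lambda>s. b m * cis (2 * pi * m * s) * cis (2 * pi * j * s))) has_sum
      integral {0..1} (\<lambda>s. \<Sum>\<^sub>\<infinity>m. b m * cis (2 * pi * m * s) * cis (2 * pi * j * s))) UNIV"
      by (rule has_sum_integral_M_test[OF _ _ bsum]) (auto simp: norm_mult intro!: continuous_intros)
    then have "((\<lambda>m. if m = - j then b m else 0) has_sum integral {0..1} (\<lambda>s. H s * cis (2 * pi * j * s))) UNIV"
      by (simp only: ch H_def infsum_cmult_left')
    moreover have "((\<lambda>m. if m = - j then b m else 0) has_sum b (- j)) UNIV"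
      using has_sum_cong_neutral[of "{- j}" UNIV "\<lambda>m. if m = - j then b m else 0" "\<lambda>m. if m = - j then b m else 0" "b (- j)"] 
        has_sum_finite[of "{- j}" "\<lambda>m. if m = - j then b m else 0"] by auto
    ultimately show ?thesis by (rule has_sum_unique)
  qed
  have "G t - H t = 0"
  proof (rule periodic_eq_0_of_fourier_coeffs_0[of "\<lambda>s. G s - H s"])
    show "continuous_on UNIV (\<lambda>s. G s - H s)" by (intro continuous_intros cG cH)
    show "G (s + 1) - H (s + 1) = G s - H s" for s by (simp add: perG perH)
    fix j :: int
    have "((\<lambda>s. G s * cis (2 * pi * j * s) - H s * cis (2 * pi * j * s)) has_integral (b (- j) - b (- j))) {0..1}"
      using Gcoeff[of j] Hcoeff[of j]
      by (intro has_integral_diff; subst has_integral_iff)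
        (auto intro!: integrable_continuous_interval continuous_intros continuous_on_subset[OF cG] continuous_on_subset[OF cH])
    then show "integral {0..1} (\<lambda>s. (G s - H s) * cis (2 * pi * j * s)) = 0"
      by (simp add: integral_unique left_diff_distrib)
  qed
  then have GH: "G t = H t" by simp
  have "(\<Sum>\<^sub>\<infinity>k::int. of_real (exp (- pi * a * (k + t)\<^sup>2)) * cis (2 * pi * y * k)) = G t * cis (- 2 * pi * y * t)"
    unfolding G_def infsum_cmult_left'[symmetric] g_def
    by (intro infsum_cong) (simp add: cis_mult algebra_simps)
  also have "\<dots> = (\<Sum>\<^sub>\<infinity>m::int. of_real (1 / sqrt a) * (of_real (exp (- pi * (m - y)\<^sup>2 / a)) * cis (2 * pi * (m - y) * t)))"
    unfolding GH H_def infsum_cmult_left'[symmetric]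
  proof (rule infsum_cong)
    fix m :: int
    have "cis (2 * pi * (m - y) * t) = cis (2 * pi * m * t) * cis (- 2 * pi * y * t)"
      by (simp add: cis_mult algebra_simps)
    then show "b m * cis (2 * pi * m * t) * cis (- 2 * pi * y * t)
       = of_real (1 / sqrt a) * (of_real (exp (- pi * (m - y)\<^sup>2 / a)) * cis (2 * pi * (m - y) * t))"
      by (simp add: b_def)
  qed
  finally show ?thesis by (simp only: infsum_cmult_right')
qed

subsection \<open>Positive definite forms and optimal designs\<close>

text \<open>With pointwise addition, this makes \<open>linear\<close> and \<open>bilinear\<close>
  available for points represented as functions. R^n is then a subspace cut out by
  \<open>in_Rd n\<close>, so that n can vary in inductions.\<close>

instantiation "fun" :: (type, real_vector) real_vector
begin

definition "c *\<^sub>R f = (\<lambda>x. c *\<^sub>R f x)"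

instance
  by standard (simp_all add: scaleR_fun_def fun_eq_iff scaleR_add_right scaleR_add_left)

end

lemma scaleR_fun_apply [simp]: "(c *\<^sub>R f) x = c *\<^sub>R f x"
  by (simp add: scaleR_fun_def)

lemma in_Rd_add [intro]: "in_Rd n x \<Longrightarrow> in_Rd n y \<Longrightarrow> in_Rd n (x + y)"
  and in_Rd_diff [intro]: "in_Rd n x \<Longrightarrow> in_Rd n y \<Longrightarrow> in_Rd n (x - y)"
  and in_Rd_scaleR [intro]: "in_Rd n x \<Longrightarrow> in_Rd n (a *\<^sub>R x)"
  and in_Rd_0 [intro, simp]: "in_Rd n 0"
  and in_Rd_Suc [intro]: "in_Rd n x \<Longrightarrow> in_Rd (Suc n) x"
  by (auto simp: in_Rd_def)

definition unit_vec :: "nat \<Rightarrow> nat \<Rightarrow> real" where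
  "unit_vec k = (\<lambda>i. if i = k then 1 else 0)"

lemma in_Rd_unit_vec [intro]: "k < n \<Longrightarrow> in_Rd n (unit_vec k)"
  by (auto simp: in_Rd_def unit_vec_def)

lemma in_Rd_upd_0 [intro]: "in_Rd (Suc n) w \<Longrightarrow> in_Rd n (w(n := 0))"
  by (auto simp: in_Rd_def Suc_le_eq)

lemma in_Rd_split: "w = w(n := 0) + w n *\<^sub>R unit_vec n"
  by (auto simp: unit_vec_def fun_eq_iff)

definition sym_form :: "((nat \<Rightarrow> real) \<Rightarrow> (nat \<Rightarrow> real) \<Rightarrow> real) \<Rightarrow> bool" where
  "sym_form B \<longleftrightarrow> bilinear B \<and> (\<forall>x y. B x y = B y x)"

text \<open>Bilinearity and symmetry are global, and only definiteness refers to R^n; the same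
  \<open>B\<close> therefore serves every dimension of an induction.\<close>

definition pos_def_on :: "nat \<Rightarrow> ((nat \<Rightarrow> real) \<Rightarrow> (nat \<Rightarrow> real) \<Rightarrow> real) \<Rightarrow> bool" where
  "pos_def_on n B \<longleftrightarrow> (\<forall>x. in_Rd n x \<longrightarrow> x \<noteq> 0 \<longrightarrow> 0 < B x x)"

lemma pos_def_on_SucD: "pos_def_on (Suc n) B \<Longrightarrow> pos_def_on n B"
  by (auto simp: pos_def_on_def)

lemma sym_form_commute: "sym_form B \<Longrightarrow> B x y = B y x"
  by (simp add: sym_form_def)

lemma sym_form_linear: "sym_form B \<Longrightarrow> linear (B x)"
  by (simp add: sym_form_def bilinear_def)

lemma
  assumes "sym_form B"
  shows sym_form_add_left: "B (x + y) z = B x z + B y z"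
    and sym_form_add_right: "B z (x + y) = B z x + B z y"
    and sym_form_diff_left: "B (x - y) z = B x z - B y z"
    and sym_form_diff_right: "B z (x - y) = B z x - B z y"
    and sym_form_scaleR_left: "B (a *\<^sub>R x) z = a * B x z"
    and sym_form_scaleR_right: "B z (a *\<^sub>R x) = a * B z x"
    and sym_form_minus_left: "B (- x) z = - B x z"
    and sym_form_minus_right: "B z (- x) = - B z x"
    and sym_form_0_left: "B 0 z = 0"
    and sym_form_0_right: "B z 0 = 0"
  using assms 
  by (auto simp: sym_form_def bilinear_ladd bilinear_radd bilinear_lsub bilinear_rsub bilinear_lmul bilinear_rmul
      bilinear_lneg bilinear_rneg bilinear_lzero bilinear_rzero)

lemmas sym_form_simps = sym_form_add_left sym_form_add_right sym_form_diff_left sym_form_diff_right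
  sym_form_scaleR_left sym_form_scaleR_right sym_form_minus_left sym_form_minus_right sym_form_0_left sym_form_0_right

lemma pos_def_on_nonneg: "sym_form B \<Longrightarrow> pos_def_on n B \<Longrightarrow> in_Rd n x \<Longrightarrow> 0 \<le> B x x"
  by (cases "x = 0") (auto simp: pos_def_on_def sym_form_simps less_imp_le)

lemma form_Cauchy_Schwarz:
  assumes B: "sym_form B" "pos_def_on n B" and x: "in_Rd n x" and y: "in_Rd n y"
  shows "(B x y)\<^sup>2 \<le> B x x * B y y"
proof (cases "y = 0")
  case False
  then have yy: "B y y > 0" using B y by (simp add: pos_def_on_def)
  have "0 \<le> B (x - (B x y / B y y) *\<^sub>R y) (x - (B x y / B y y) *\<^sub>R y)"
    using x y by (intro pos_def_on_nonneg[OF B] in_Rd_diff in_Rd_scaleR)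
  also have "\<dots> = B x x - (B x y)\<^sup>2 / B y y"
    using yy by (simp add: sym_form_simps[OF B(1)] sym_form_commute[OF B(1), of y x] power2_eq_square field_simps)
  finally show ?thesis using yy by (simp add: field_simps)
qed (simp add: sym_form_simps[OF B(1)])

text \<open>Gram-Schmidt: the induction hypothesis for \<open>B (unit_vec n)\<close> yields the
  projection \<open>h\<close> of the new basis vector to R^n. The difference \<open>g\<close> is
  orthogonal to R^n, so the representative in R^n needs only a multiple of \<open>g\<close>
  added.\<close>

lemma riesz_exists:
  assumes B: "sym_form B" and "pos_def_on n B" "linear f"
  shows "\<exists>\<eta>. in_Rd n \<eta> \<and> (\<forall>w. in_Rd n w \<longrightarrow> B \<eta> w = f w)"
  using assms(2,3)
proof (induction n arbitrary: f)
  case 0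
  then show ?case by (auto intro!: exI[of _ 0] simp: in_Rd_def sym_form_simps[OF B] linear_0 zero_fun_def[symmetric])
next
  case (Suc n)
  have pd: "pos_def_on n B" using Suc.prems(1) by (rule pos_def_on_SucD)
  obtain h where h: "in_Rd n h" "\<And>w. in_Rd n w \<Longrightarrow> B h w = B (unit_vec n) w"
    using Suc.IH[OF pd sym_form_linear[OF B]] by blast
  obtain \<eta> where \<eta>: "in_Rd n \<eta>" "\<And>w. in_Rd n w \<Longrightarrow> B \<eta> w = f w"
    using Suc.IH[OF pd Suc.prems(2)] by blast
  define g where "g = unit_vec n - h"
  have g: "in_Rd (Suc n) g" "\<And>w. in_Rd n w \<Longrightarrow> B g w = 0"
    using h by (auto simp: g_def sym_form_simps[OF B])
  have "g n = 1" using h(1) by (simp add: g_def unit_vec_def in_Rd_def)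
  then have "g \<noteq> 0" by auto
  then have s: "B g g > 0" using Suc.prems(1) g by (simp add: pos_def_on_def)
  define z where "z = \<eta> + (f g / B g g) *\<^sub>R g"
  have "B z w = f w" if w: "in_Rd (Suc n) w" for w
  proof -
    define u where "u = w(n := 0) + w n *\<^sub>R h"
    have u: "in_Rd n u" using w h by (auto simp: u_def)
    have wu: "w = u + w n *\<^sub>R g"
      using in_Rd_split[of w n] by (simp add: u_def g_def algebra_simps)
    have "B \<eta> g = 0" using g(2)[OF \<eta>(1)] sym_form_commute[OF B] by simp
    have "B z w = B z (u + w n *\<^sub>R g)" using wu by simp
    also have "\<dots> = f u + w n * f g"
      using s g(2)[OF u] \<eta>(2)[OF u] \<open>B \<eta> g = 0\<close> by (simp add: z_def sym_form_simps[OF B] field_simps)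
    also have "\<dots> = f (u + w n *\<^sub>R g)"
      using Suc.prems(2) by (simp add: linear_add linear_cmul)
    finally show ?thesis using wu by simp
  qed
  moreover have "in_Rd (Suc n) z" using \<eta>(1) g by (auto simp: z_def)
  ultimately show ?case by blast
qed

section \<open>Inverse form, Gram-Schmidt vectors and determinants\<close>

definition riesz :: "nat \<Rightarrow> ((nat \<Rightarrow> real) \<Rightarrow> (nat \<Rightarrow> real) \<Rightarrow> real) \<Rightarrow> ((nat \<Rightarrow> real) \<Rightarrow> real) \<Rightarrow> nat \<Rightarrow> real" where
  "riesz n B f = (SOME \<eta>. in_Rd n \<eta> \<and> (\<forall>w. in_Rd n w \<longrightarrow> B \<eta> w = f w))"

lemma
  assumes "sym_form B" "pos_def_on n B" "linear f"
  shows in_Rd_riesz: "in_Rd n (riesz n B f)"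
    and form_riesz: "in_Rd n w \<Longrightarrow> B (riesz n B f) w = f w"
  using someI_ex[OF riesz_exists[OF assms]] by (auto simp: riesz_def)

lemma riesz_eqI:
  assumes B: "sym_form B" "pos_def_on n B" and f: "linear f"
    and \<eta>: "in_Rd n \<eta>" "\<And>w. in_Rd n w \<Longrightarrow> B \<eta> w = f w"
  shows "riesz n B f = \<eta>"
proof (rule ccontr)
  assume "riesz n B f \<noteq> \<eta>"
  moreover have "in_Rd n (riesz n B f - \<eta>)" using in_Rd_riesz[OF B f] \<eta> by auto
  ultimately have "B (riesz n B f - \<eta>) (riesz n B f - \<eta>) > 0" using B by (simp add: pos_def_on_def)
  moreover have "B (riesz n B f - \<eta>) (riesz n B f - \<eta>) = 0"
    using \<eta>(2) form_riesz[OF B f] \<open>in_Rd n (riesz n B f - \<eta>)\<close> by (simp add: sym_form_diff_left[OF B(1)])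
  ultimately show False by simp
qed

text \<open>The inverse quadratic form: in matrix terms \<open>riesz n B f\<close> is B^(-1) f, so
  this is f^T B^(-1) f. Cauchy-Schwarz makes it the constant in
  \<open>square_le_dual_form\<close>.\<close>

definition dual_form :: "nat \<Rightarrow> ((nat \<Rightarrow> real) \<Rightarrow> (nat \<Rightarrow> real) \<Rightarrow> real) \<Rightarrow> ((nat \<Rightarrow> real) \<Rightarrow> real) \<Rightarrow> real" where
  "dual_form n B f = B (riesz n B f) (riesz n B f)"

text \<open>The unnormalised Gram-Schmidt vector: the part of \<open>unit_vec n\<close> orthogonal
  to the coordinates below n. Leaving its last coordinate equal to 1 lets an integer coordinate
  enter the lattice sums unscaled.\<close>

definition gs_vec :: "nat \<Rightarrow> ((nat \<Rightarrow> real) \<Rightarrow> (nat \<Rightarrow> real) \<Rightarrow> real) \<Rightarrow> nat \<Rightarrow> real" where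
  "gs_vec n B = unit_vec n - riesz n B (B (unit_vec n))"

lemma
  assumes B: "sym_form B" "pos_def_on n B"
  shows in_Rd_gs_vec: "in_Rd (Suc n) (gs_vec n B)"
    and gs_vec_last: "gs_vec n B n = 1"
    and form_gs_vec_left: "in_Rd n w \<Longrightarrow> B (gs_vec n B) w = 0"
    and form_gs_vec_right: "in_Rd n w \<Longrightarrow> B w (gs_vec n B) = 0"
proof -
  note r = in_Rd_riesz[OF B sym_form_linear[OF B(1)]] form_riesz[OF B sym_form_linear[OF B(1)]]
  show "in_Rd (Suc n) (gs_vec n B)" "gs_vec n B n = 1"
    using r(1)[of "unit_vec n"] by (auto simp: gs_vec_def unit_vec_def in_Rd_def)
  show left: "in_Rd n w \<Longrightarrow> B (gs_vec n B) w = 0"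
    by (simp add: gs_vec_def sym_form_simps[OF B(1)] r(2))
  then show "in_Rd n w \<Longrightarrow> B w (gs_vec n B) = 0" using sym_form_commute[OF B(1)] by simp
qed

lemma form_gs_vec_pos:
  assumes B: "sym_form B" "pos_def_on (Suc n) B"
  shows "B (gs_vec n B) (gs_vec n B) > 0"
proof -
  note pd = pos_def_on_SucD[OF B(2)]
  have "gs_vec n B \<noteq> 0" using gs_vec_last[OF B(1) pd] by auto
  then show ?thesis using B(2) in_Rd_gs_vec[OF B(1) pd] by (simp add: pos_def_on_def)
qed

lemma gs_vec_eqI:
  assumes B: "sym_form B" "pos_def_on n B" and g: "in_Rd n (unit_vec n - g)" "\<And>w. in_Rd n w \<Longrightarrow> B g w = 0"
  shows "gs_vec n B = g"
proof -
  have "riesz n B (B (unit_vec n)) = unit_vec n - g"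
    using B g by (intro riesz_eqI sym_form_linear) (auto simp: sym_form_simps)
  then show ?thesis by (simp add: gs_vec_def)
qed

lemma riesz_Suc:
  assumes B: "sym_form B" "pos_def_on (Suc n) B" and f: "linear f"
  defines "g \<equiv> gs_vec n B"
  shows "riesz (Suc n) B f = riesz n B f + (f g / B g g) *\<^sub>R g"
proof (rule riesz_eqI[OF B f])
  note pd = pos_def_on_SucD[OF B(2)]
  note r = in_Rd_riesz[OF B(1) pd f] form_riesz[OF B(1) pd f]
  note g = in_Rd_gs_vec[OF B(1) pd, folded g_def] form_gs_vec_left[OF B(1) pd, folded g_def]
    form_gs_vec_right[OF B(1) pd, folded g_def] gs_vec_last[OF B(1) pd, folded g_def]
  have s: "B g g > 0" unfolding g_def by (rule form_gs_vec_pos[OF B])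
  show "in_Rd (Suc n) (riesz n B f + (f g / B g g) *\<^sub>R g)" using r g by auto
  fix w :: "nat \<Rightarrow> real" assume w: "in_Rd (Suc n) w"
  define u where "u = w - w n *\<^sub>R g"
  have u: "in_Rd n u"
    unfolding in_Rd_def u_def
  proof (intro allI impI)
    fix i assume "n \<le> i"
    then consider "i = n" | "i \<ge> Suc n" by linarith
    then show "(w - w n *\<^sub>R g) i = 0" using w g(1) g(4) by cases (auto simp: in_Rd_def)
  qed
  have wu: "w = u + w n *\<^sub>R g" by (simp add: u_def)
  have "B (riesz n B f + (f g / B g g) *\<^sub>R g) (u + w n *\<^sub>R g) = f u + w n * f g"
    using s r(2)[OF u] g(2)[OF u] g(3)[OF r(1)] by (simp add: sym_form_simps[OF B(1)] field_simps)
  also have "\<dots> = f (u + w n *\<^sub>R g)" using f by (simp add: linear_add linear_cmul)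
  finally show "B (riesz n B f + (f g / B g g) *\<^sub>R g) w = f w" using wu by simp
qed

text \<open>Pythagoras for the splitting of R^(n+1) into R^n and the orthogonal line; in matrix
  terms, the Schur complement formula for the inverse. The determinant update and the Poisson
  formula in n variables both rest on it.\<close>

lemma dual_form_Suc:
  assumes B: "sym_form B" "pos_def_on (Suc n) B" and f: "linear f"
  shows "dual_form (Suc n) B f = dual_form n B f + (f (gs_vec n B))\<^sup>2 / B (gs_vec n B) (gs_vec n B)"
proof -
  note pd = pos_def_on_SucD[OF B(2)]
  note r = in_Rd_riesz[OF B(1) pd f]
  show ?thesis
    using form_gs_vec_pos[OF B] form_gs_vec_left[OF B(1) pd r] form_gs_vec_right[OF B(1) pd r]
    unfolding dual_form_def riesz_Suc[OF B f]
    by (simp add: sym_form_simps[OF B(1)] power2_eq_square)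
qed

lemma dual_form_0:
  assumes "linear f" "sym_form B"
  shows "dual_form 0 B f = 0"
proof -
  have "pos_def_on 0 B" by (auto simp: pos_def_on_def in_Rd_def fun_eq_iff)
  then have "in_Rd 0 (riesz 0 B f)" using in_Rd_riesz assms by blast
  then have "riesz 0 B f = 0" by (auto simp: in_Rd_def fun_eq_iff)
  then show ?thesis using assms by (simp add: dual_form_def sym_form_simps)
qed

lemma dual_form_nonneg: "sym_form B \<Longrightarrow> pos_def_on n B \<Longrightarrow> linear f \<Longrightarrow> 0 \<le> dual_form n B f"
  unfolding dual_form_def by (rule pos_def_on_nonneg[OF _ _ in_Rd_riesz[of B n f]])

lemma square_le_dual_form:
  assumes "sym_form B" "pos_def_on n B" "linear f" "in_Rd n w"
  shows "(f w)\<^sup>2 \<le> dual_form n B f * B w w"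
  using form_Cauchy_Schwarz[OF assms(1,2) in_Rd_riesz[OF assms(1-3)] assms(4)] form_riesz[OF assms(1-3)] assms(4)
  by (simp add: dual_form_def)

text \<open>The determinant of the Gram matrix, read off from the Gram-Schmidt process.\<close>

definition gram_det :: "nat \<Rightarrow> ((nat \<Rightarrow> real) \<Rightarrow> (nat \<Rightarrow> real) \<Rightarrow> real) \<Rightarrow> real" where
  "gram_det n B = (\<Prod>k<n. B (gs_vec k B) (gs_vec k B))"

lemma gram_det_pos:
  assumes B: "sym_form B" "pos_def_on n B"
  shows "gram_det n B > 0"
proof -
  have "pos_def_on (Suc k) B" if "k < n" for k
    using B(2) that unfolding pos_def_on_def by (meson in_Rd_def le_trans Suc_leI)
  then show ?thesis unfolding gram_det_def using form_gs_vec_pos[OF B(1)] by (intro prod_pos) auto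
qed

lemma sym_form_rank_one:
  assumes "sym_form B" "linear f"
  shows "sym_form (\<lambda>x y. B x y + t * (f x * f y))"
  using assms unfolding sym_form_def bilinear_def
  by (auto intro!: linearI simp: linear_add linear_cmul algebra_simps)

lemma pos_def_on_rank_one:
  assumes "pos_def_on n B" "t \<ge> 0"
  shows "pos_def_on n (\<lambda>x y. B x y + t * (f x * f y))"
  using assms by (auto simp: pos_def_on_def intro!: add_pos_nonneg)

text \<open>The matrix determinant lemma det (B + t f f^T) = det B (1 + t f^T B^(-1) f). As the
  determinant is a product over the Gram-Schmidt process, one factor is compared in each step of the
  induction.\<close>

lemma gram_det_rank_one:
  assumes B: "sym_form B" and "pos_def_on n B" and f: "linear f" and t: "t \<ge> 0"
  shows "gram_det n (\<lambda>x y. B x y + t * (f x * f y)) = gram_det n B * (1 + t * dual_form n B f)"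
  using assms(2)
proof (induction n)
  case 0
  then show ?case by (simp add: gram_det_def dual_form_0[OF f B])
next
  case (Suc n)
  note pd = pos_def_on_SucD[OF Suc.prems]
  let ?B = "\<lambda>x y. B x y + t * (f x * f y)"
  note B' = sym_form_rank_one[OF B f] and pd' = pos_def_on_rank_one[OF pd t]
  define g \<eta> \<alpha> where "g = gs_vec n B" and "\<eta> = riesz n B f" and "\<alpha> = dual_form n B f"
  have \<alpha>: "\<alpha> \<ge> 0" unfolding \<alpha>_def by (rule dual_form_nonneg[OF B pd f])
  then have pos: "1 + t * \<alpha> > 0" using t by (intro add_pos_nonneg) auto
  have \<eta>: "in_Rd n \<eta>" "\<And>w. in_Rd n w \<Longrightarrow> B \<eta> w = f w"
    unfolding \<eta>_def using in_Rd_riesz[OF B pd f] form_riesz[OF B pd f] by auto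
  have f\<eta>: "f \<eta> = \<alpha>" using \<eta>(2)[OF \<eta>(1)] by (simp add: \<alpha>_def dual_form_def \<eta>_def)
  have "unit_vec n - g = riesz n B (B (unit_vec n))" by (simp add: g_def gs_vec_def)
  then have g: "in_Rd n (unit_vec n - g)" "\<And>w. in_Rd n w \<Longrightarrow> B g w = 0" "\<And>w. in_Rd n w \<Longrightarrow> B w g = 0"
    using in_Rd_riesz[OF B pd sym_form_linear[OF B], of "unit_vec n"] form_gs_vec_left[OF B pd] form_gs_vec_right[OF B pd]
    by (simp_all add: g_def)
  \<comment> \<open>Comes from requiring g - \<tau> \<eta> to be orthogonal to R^n for the updated
    form, which amounts to t f(g) = \<tau> (1 + t \<alpha>).\<close>
  define \<tau> where "\<tau> = t * f g / (1 + t * \<alpha>)"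
  have g': "gs_vec n ?B = g - \<tau> *\<^sub>R \<eta>"
  proof (rule gs_vec_eqI[OF B' pd'])
    have "unit_vec n - (g - \<tau> *\<^sub>R \<eta>) = (unit_vec n - g) + \<tau> *\<^sub>R \<eta>" by simp
    then show "in_Rd n (unit_vec n - (g - \<tau> *\<^sub>R \<eta>))"
      using in_Rd_add[OF g(1) in_Rd_scaleR[OF \<eta>(1)]] by metis
    fix w :: "nat \<Rightarrow> real" assume w: "in_Rd n w"
    have "B (g - \<tau> *\<^sub>R \<eta>) w + t * (f (g - \<tau> *\<^sub>R \<eta>) * f w) = (t * f g - \<tau> * (1 + t * \<alpha>)) * f w"
      using g(2)[OF w] \<eta>(2)[OF w] f f\<eta> by (simp add: sym_form_simps[OF B] linear_diff linear_cmul algebra_simps)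
    also have "\<dots> = 0" using pos by (simp add: \<tau>_def)
    finally show "B (g - \<tau> *\<^sub>R \<eta>) w + t * (f (g - \<tau> *\<^sub>R \<eta>) * f w) = 0" .
  qed
  have "?B (gs_vec n ?B) (gs_vec n ?B) = B g g + \<tau>\<^sup>2 * \<alpha> + t * (f g - \<tau> * \<alpha>)\<^sup>2"
    using g(2)[OF \<eta>(1)] g(3)[OF \<eta>(1)] \<eta>(2)[OF \<eta>(1)] f f\<eta> unfolding g'
    by (simp add: sym_form_simps[OF B] linear_diff linear_cmul power2_eq_square)
  moreover have "\<tau>\<^sup>2 * \<alpha> + t * (f g - \<tau> * \<alpha>)\<^sup>2 = t * (f g)\<^sup>2 / (1 + t * \<alpha>)"
  proof -
    have "f g - \<tau> * \<alpha> = f g / (1 + t * \<alpha>)" using pos by (simp add: \<tau>_def field_simps)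
    then have "\<tau>\<^sup>2 * \<alpha> + t * (f g - \<tau> * \<alpha>)\<^sup>2 = (t * (f g)\<^sup>2 * (1 + t * \<alpha>)) / (1 + t * \<alpha>)\<^sup>2"
      by (simp add: \<tau>_def power_divide add_divide_distrib[symmetric]) (simp add: power2_eq_square algebra_simps)
    then show ?thesis using pos by (simp add: power2_eq_square)
  qed
  ultimately have "?B (gs_vec n ?B) (gs_vec n ?B) = B g g + t * (f g)\<^sup>2 / (1 + t * \<alpha>)"
    by (simp add: add.assoc)
  moreover have "gram_det (Suc n) ?B = gram_det n ?B * ?B (gs_vec n ?B) (gs_vec n ?B)"
    by (simp add: gram_det_def)
  ultimately have "gram_det (Suc n) ?B = gram_det n B * (1 + t * \<alpha>) * (B g g + t * (f g)\<^sup>2 / (1 + t * \<alpha>))"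
    using Suc.IH[OF pd] by (simp add: \<alpha>_def)
  also have "\<dots> = gram_det n B * ((1 + t * \<alpha>) * B g g + t * (f g)\<^sup>2)"
    using pos by (simp add: field_simps)
  also have "(1 + t * \<alpha>) * B g g + t * (f g)\<^sup>2 = B g g * (1 + t * dual_form (Suc n) B f)"
    using form_gs_vec_pos[OF B Suc.prems] unfolding dual_form_Suc[OF B Suc.prems f]
    by (simp add: g_def \<alpha>_def field_simps)
  finally show ?case by (simp add: gram_det_def g_def)
qed

lemma gram_det_scale:
  assumes B: "sym_form B" and pd: "pos_def_on n B" and a: "a > 0"
  shows "gram_det n (\<lambda>x y. a * B x y) = a ^ n * gram_det n B"
proof -
  have gs: "gs_vec k (\<lambda>x y. a * B x y) = gs_vec k B" if "k < n" for k
  proof (rule gs_vec_eqI)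
    have pdk: "pos_def_on k B"
      using pd that unfolding pos_def_on_def by (meson in_Rd_def le_trans less_imp_le)
    show "sym_form (\<lambda>x y. a * B x y)"
      using B unfolding sym_form_def bilinear_def by (auto intro!: linearI simp: linear_add linear_cmul algebra_simps)
    show "pos_def_on k (\<lambda>x y. a * B x y)" using pdk a by (auto simp: pos_def_on_def)
    show "in_Rd k (unit_vec k - gs_vec k B)"
      using in_Rd_riesz[OF B pdk sym_form_linear[OF B]] by (simp add: gs_vec_def)
    show "in_Rd k w \<Longrightarrow> a * B (gs_vec k B) w = 0" for w
      using form_gs_vec_left[OF B pdk] by simp
  qed
  have "gram_det n (\<lambda>x y. a * B x y) = (\<Prod>k<n. a * B (gs_vec k B) (gs_vec k B))"
    unfolding gram_det_def using gs by (intro prod.cong) auto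
  then show ?thesis by (simp add: gram_det_def prod.distrib)
qed

text \<open>Hadamard's inequality: removing the projection to the earlier coordinates cannot
  lengthen a vector. It keeps the supremum over all designs finite.\<close>

lemma gram_det_le:
  assumes B: "sym_form B" and pd: "pos_def_on n B"
  shows "gram_det n B \<le> (\<Prod>k<n. B (unit_vec k) (unit_vec k))"
  unfolding gram_det_def
proof (intro prod_mono conjI)
  fix k assume "k \<in> {..<n}"
  then have pdk: "pos_def_on k B" "pos_def_on (Suc k) B"
    using pd unfolding pos_def_on_def by (auto, (meson in_Rd_def le_trans less_imp_le Suc_leI)+)
  define h where "h = riesz k B (B (unit_vec k))"
  have h: "in_Rd k h" unfolding h_def by (rule in_Rd_riesz[OF B pdk(1) sym_form_linear[OF B]])
  have u: "unit_vec k = gs_vec k B + h" by (simp add: gs_vec_def h_def)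
  have "B (unit_vec k) (unit_vec k) = B (gs_vec k B) (gs_vec k B) + B h h"
    using form_gs_vec_left[OF B pdk(1) h] form_gs_vec_right[OF B pdk(1) h] unfolding u by (simp add: sym_form_simps[OF B])
  then show "B (gs_vec k B) (gs_vec k B) \<le> B (unit_vec k) (unit_vec k)"
    using pos_def_on_nonneg[OF B pdk(1) h] by simp
  show "0 \<le> B (gs_vec k B) (gs_vec k B)" using form_gs_vec_pos[OF B pdk(2)] by simp
qed

section \<open>Near-optimal designs\<close>

definition weighted_form :: "'i set \<Rightarrow> ('i \<Rightarrow> (nat \<Rightarrow> real) \<Rightarrow> real) \<Rightarrow> ('i \<Rightarrow> real) \<Rightarrow> (nat \<Rightarrow> real) \<Rightarrow> (nat \<Rightarrow> real) \<Rightarrow> real" where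
  "weighted_form I f c x y = (\<Sum>i\<in>I. c i * (f i x * f i y))"

lemma sym_form_weighted_form: "(\<And>i. i \<in> I \<Longrightarrow> linear (f i)) \<Longrightarrow> sym_form (weighted_form I f c)"
  unfolding sym_form_def bilinear_def weighted_form_def
  by (auto intro!: linearI sum.cong simp: linear_add linear_cmul algebra_simps sum.distrib sum_distrib_left)

text \<open>The variational argument for D-optimal designs, as in the Kiefer-Wolfowitz theorem, run
  with weights whose determinant exceeds half the supremum. Moving mass towards a single i can at
  most double the determinant; the rank-one update turns this into a bound for the inverse form at
  \<open>f i\<close>, and Cauchy-Schwarz into the claim.\<close>

lemma optimal_design:
  fixes f :: "'i \<Rightarrow> (nat \<Rightarrow> real) \<Rightarrow> real"
  assumes I: "finite I" and lin: "\<And>i. i \<in> I \<Longrightarrow> linear (f i)" and n: "n \<ge> 1"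
    and sep: "\<And>w. in_Rd n w \<Longrightarrow> w \<noteq> 0 \<Longrightarrow> \<exists>i\<in>I. f i w \<noteq> 0"
  obtains c where "\<And>i. i \<in> I \<Longrightarrow> 0 \<le> c i" "sum c I = 1" "pos_def_on n (weighted_form I f c)"
    "\<And>i w. i \<in> I \<Longrightarrow> in_Rd n w \<Longrightarrow> (f i w)\<^sup>2 \<le> 5 * real n * weighted_form I f c w w"
proof -
  define C where "C = {c. (\<forall>i\<in>I. 0 \<le> c i) \<and> sum c I = 1 \<and> pos_def_on n (weighted_form I f c)}"
  have Ine: "I \<noteq> {}"
  proof -
    have "unit_vec 0 0 \<noteq> (0 :: nat \<Rightarrow> real) 0" by (simp add: unit_vec_def)
    then have "unit_vec 0 \<noteq> 0" by metis
    then show ?thesis using sep[of "unit_vec 0"] n in_Rd_unit_vec[of 0 n] by auto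
  qed
  have cn: "card I > 0" using I Ine by (simp add: card_gt_0_iff)
  have unif: "(\<lambda>_. 1 / card I) \<in> C"
  proof -
    have "0 < weighted_form I f (\<lambda>_. 1 / card I) w w" if "in_Rd n w" "w \<noteq> 0" for w
      using sep[OF that] I cn unfolding weighted_form_def by (auto intro!: sum_pos2 divide_pos_pos simp: zero_less_mult_iff)
    then show ?thesis using cn by (auto simp: C_def pos_def_on_def)
  qed
  define D where "D = (\<lambda>c. gram_det n (weighted_form I f c))"
  define K where "K = (\<Prod>k<n. \<Sum>i\<in>I. (f i (unit_vec k))\<^sup>2)"
  have bound: "D c \<le> K" if "c \<in> C" for c
  proof -
    have c: "\<And>i. i \<in> I \<Longrightarrow> 0 \<le> c i" "sum c I = 1" "pos_def_on n (weighted_form I f c)" using that by (auto simp: C_def)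
    have c1: "c i \<le> 1" if "i \<in> I" for i using member_le_sum[of i I c] c I that by auto
    have "D c \<le> (\<Prod>k<n. weighted_form I f c (unit_vec k) (unit_vec k))"
      unfolding D_def by (rule gram_det_le[OF sym_form_weighted_form c(3)]) (use lin in auto)
    also have "\<dots> \<le> K"
      unfolding K_def weighted_form_def power2_eq_square
      using c c1 by (intro prod_mono conjI sum_nonneg sum_mono mult_left_le_one_le) auto
    finally show ?thesis .
  qed
  define S where "S = Sup (D ` C)"
  have bdd: "bdd_above (D ` C)" using bound by (auto intro!: bdd_aboveI2)
  have Dpos: "D c > 0" if "c \<in> C" for c
    unfolding D_def using that lin by (intro gram_det_pos sym_form_weighted_form) (auto simp: C_def)
  have Spos: "S > 0" using cSup_upper[OF imageI[OF unif] bdd] Dpos[OF unif] by (simp add: S_def)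
  then have "S / 2 < Sup (D ` C)" by (simp add: S_def)
  then obtain c where c: "c \<in> C" "S / 2 < D c"
    using less_cSup_iff[OF _ bdd, of "S / 2"] unif by blast
  have c': "\<And>i. i \<in> I \<Longrightarrow> 0 \<le> c i" "sum c I = 1" "pos_def_on n (weighted_form I f c)" using c by (auto simp: C_def)
  note sf = sym_form_weighted_form[of I f c, OF lin]
  have dual: "dual_form n (weighted_form I f c) (f i) \<le> 5 * real n" if i: "i \<in> I" for i
  proof -
    \<comment> \<open>For this t, t / (1 - t) = 1 / n and (1 - t)^n \<ge> 1 / e \<ge> 1 / 3.
      Doubling at most then reads 1 + \<delta> / n \<le> 6 for the value \<delta> of the inverse
      form, whence the constant 5.\<close>
    define t where "t = 1 / (real n + 1)"
    have t: "0 < t" "t < 1" using n by (auto simp: t_def)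
    define c2 where "c2 = (\<lambda>j. (1 - t) * c j + (if j = i then t else 0))"
    define B2 where "B2 = (\<lambda>x y. weighted_form I f c x y + t / (1 - t) * (f i x * f i y))"
    have w2: "weighted_form I f c2 = (\<lambda>x y. (1 - t) * B2 x y)"
    proof (intro ext)
      fix x y
      have "weighted_form I f c2 x y = (\<Sum>j\<in>I. (1 - t) * (c j * (f j x * f j y)) + (if j = i then t * (f i x * f i y) else 0))"
        unfolding weighted_form_def c2_def by (intro sum.cong) (auto simp: algebra_simps)
      also have "\<dots> = (1 - t) * weighted_form I f c x y + t * (f i x * f i y)"
        using I i by (simp add: weighted_form_def sum.distrib sum_distrib_left)
      also have "\<dots> = (1 - t) * B2 x y" using t by (simp add: B2_def distrib_left)
      finally show "weighted_form I f c2 x y = (1 - t) * B2 x y" .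
    qed
    have B2: "sym_form B2" "pos_def_on n B2"
      unfolding B2_def using sf lin[OF i] c'(3) t
    by (intro sym_form_rank_one pos_def_on_rank_one divide_nonneg_nonneg; simp)+
    have "c2 \<in> C"
    proof -
      have "sum c2 I = (1 - t) * sum c I + t"
        using I i by (simp add: c2_def sum.distrib sum_distrib_left)
      moreover have "pos_def_on n (weighted_form I f c2)" using B2(2) t unfolding w2 pos_def_on_def by simp
      ultimately show ?thesis using c' t by (auto simp: C_def c2_def)
    qed
    then have "D c2 \<le> S" using cSup_upper[OF _ bdd] by (simp add: S_def)
    also have "S \<le> 2 * D c" using c by simp
    finally have "D c2 \<le> 2 * D c" .
    moreover have "D c2 = (1 - t) ^ n * (D c * (1 + t / (1 - t) * dual_form n (weighted_form I f c) (f i)))"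
      unfolding D_def w2 using t gram_det_scale[OF B2, of "1 - t"]
        gram_det_rank_one[OF sf c'(3) lin[OF i], of "t / (1 - t)"] by (simp add: B2_def)
    ultimately have "D c * ((1 - t) ^ n * (1 + t / (1 - t) * dual_form n (weighted_form I f c) (f i))) \<le> D c * 2" by (simp add: ac_simps)
    then have le2: "(1 - t) ^ n * (1 + t / (1 - t) * dual_form n (weighted_form I f c) (f i)) \<le> 2"
      using Dpos[OF c(1)] by simp
    have tt: "t / (1 - t) = 1 / n" using n by (simp add: t_def field_simps)
    have "1 / 3 \<le> (1 - t) ^ n"
    proof -
      have "(1 + 1 / real n) ^ n \<le> exp (1 / real n) ^ n"
        by (intro power_mono exp_ge_add_one_self) auto
      also have "\<dots> = exp 1" using n by (simp add: exp_of_nat_mult[symmetric])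
      also have "\<dots> \<le> 3" by (rule exp_le)
      finally have "(1 + 1 / real n) ^ n \<le> 3" .
      moreover have "1 - t = real n / (real n + 1)" "1 + 1 / real n = (real n + 1) / real n"
        using n by (simp_all add: t_def field_simps)
      then have "(1 - t) * (1 + 1 / real n) = 1" using n by simp
      then have "(1 - t) ^ n * (1 + 1 / real n) ^ n = 1" by (simp add: power_mult_distrib[symmetric])
      moreover have "(1 - t) ^ n \<ge> 0" using t by simp
      ultimately have "1 \<le> (1 - t) ^ n * 3"
        using mult_left_mono[of "(1 + 1 / real n) ^ n" 3 "(1 - t) ^ n"] by linarith
      then show ?thesis by simp
    qed
    then have "1 / 3 * (1 + 1 / n * dual_form n (weighted_form I f c) (f i))
        \<le> (1 - t) ^ n * (1 + 1 / n * dual_form n (weighted_form I f c) (f i))"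
      using dual_form_nonneg[OF sf c'(3) lin[OF i]] by (intro mult_right_mono) auto
    also have "\<dots> \<le> 2" using le2 unfolding tt .
    finally have "1 / 3 * (1 + 1 / n * dual_form n (weighted_form I f c) (f i)) \<le> 2" .
    then show ?thesis using n by (simp add: field_simps)
  qed
  show ?thesis
  proof (rule that[OF c'])
    fix i w assume i: "i \<in> I" and w: "in_Rd n w"
    have "(f i w)\<^sup>2 \<le> dual_form n (weighted_form I f c) (f i) * weighted_form I f c w w"
      by (rule square_le_dual_form[OF sf c'(3) lin[OF i] w])
    also have "\<dots> \<le> 5 * real n * weighted_form I f c w w"
      using dual[OF i] pos_def_on_nonneg[OF sf c'(3) w] by (intro mult_right_mono) auto
    finally show "(f i w)\<^sup>2 \<le> 5 * real n * weighted_form I f c w w" .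
  qed
qed

subsection \<open>Poisson summation for Gaussians on lattices\<close>

no_notation Infinite_Set_Sum.abs_summable_on (infix \<open>abs'_summable'_on\<close> 50)

lemma infsum_complex_of_real: "infsum (\<lambda>x. complex_of_real (f x)) A = of_real (infsum f A)"
proof (cases "f summable_on A")
  case True
  then show ?thesis by (intro infsumI has_sum_of_real) auto
next
  \<comment> \<open>Without summability both sides are the default value 0 of
    \<open>infsum\<close>.\<close>
  case False
  then have "\<not> (\<lambda>x. complex_of_real (f x)) summable_on A"
    using summable_on_Re[of "\<lambda>x. complex_of_real (f x)" A] by auto
  with False show ?thesis by (simp add: infsum_not_exists)
qed

section \<open>The pairing and the integer lattice, one coordinate at a time\<close>

definition ip :: "nat \<Rightarrow> (nat \<Rightarrow> real) \<Rightarrow> (nat \<Rightarrow> real) \<Rightarrow> real" where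
  "ip n x w = (\<Sum>i<n. x i * w i)"

lemma ip_add_left: "ip n (x + y) w = ip n x w + ip n y w"
  and ip_diff_left: "ip n (x - y) w = ip n x w - ip n y w"
  and ip_scaleR_left: "ip n (a *\<^sub>R x) w = a * ip n x w"
  and ip_add_right: "ip n w (x + y) = ip n w x + ip n w y"
  and ip_diff_right: "ip n w (x - y) = ip n w x - ip n w y"
  and ip_scaleR_right: "ip n w (a *\<^sub>R x) = a * ip n w x"
  and ip_0_left: "ip n 0 w = 0"
  and ip_0_right: "ip n w 0 = 0"
  by (simp_all add: ip_def sum.distrib sum_subtractf sum_distrib_left algebra_simps)

lemmas ip_simps = ip_add_left ip_diff_left ip_scaleR_left ip_add_right ip_diff_right ip_scaleR_right
  ip_0_left ip_0_right

lemma ip_commute: "ip n x w = ip n w x"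
  by (simp add: ip_def mult.commute)

lemma ip_cong: "(\<And>i. i < n \<Longrightarrow> x i = x' i) \<Longrightarrow> (\<And>i. i < n \<Longrightarrow> w i = w' i) \<Longrightarrow> ip n x w = ip n x' w'"
  by (simp add: ip_def)

lemma ip_Suc: "ip (Suc n) x w = ip n x w + x n * w n"
  by (simp add: ip_def)

lemma linear_ip: "linear (ip n x)"
  by (rule linearI) (simp_all add: ip_simps)

lemma dual_form_cong:
  assumes "\<And>w. in_Rd n w \<Longrightarrow> f w = f' w"
  shows "dual_form n B f = dual_form n B f'"
proof -
  have "riesz n B f = riesz n B f'"
    unfolding riesz_def using assms by (metis (mono_tags, lifting))
  then show ?thesis by (simp add: dual_form_def)
qed

abbreviation lattice :: "nat \<Rightarrow> (nat \<Rightarrow> real) set" where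
  "lattice n \<equiv> {z. lattice_pt n z}"

lemma bij_betw_lattice_Suc:
  "bij_betw (\<lambda>(z, k). z(n := real_of_int k)) (lattice n \<times> UNIV) (lattice (Suc n))"
proof (rule bij_betw_byWitness[where f' = "\<lambda>z. (z(n := 0), \<lfloor>z n\<rfloor>)"])
  show "\<forall>a\<in>lattice n \<times> UNIV. (\<lambda>z. (z(n := 0), \<lfloor>z n\<rfloor>)) (case a of (z, k) \<Rightarrow> z(n := real_of_int k)) = a"
    by (auto simp: lattice_pt_def in_Rd_def fun_eq_iff)
  show "\<forall>z\<in>lattice (Suc n). (case (z(n := 0), \<lfloor>z n\<rfloor>) of (z, k) \<Rightarrow> z(n := real_of_int k)) = z"
    by (auto simp: lattice_pt_def fun_eq_iff Ints_def)
  show "(\<lambda>(z, k). z(n := real_of_int k)) ` (lattice n \<times> UNIV) \<subseteq> lattice (Suc n)"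
    by (auto simp: lattice_pt_def in_Rd_def less_Suc_eq)
  show "(\<lambda>z. (z(n := 0), \<lfloor>z n\<rfloor>)) ` lattice (Suc n) \<subseteq> lattice n \<times> UNIV"
    using in_Rd_upd_0 by (auto simp: lattice_pt_def)
qed

lemma lattice_0: "lattice 0 = {0}"
  by (auto simp: lattice_pt_def in_Rd_def fun_eq_iff)

lemma abs_summable_on_TimesI:
  fixes f :: "'a \<times> 'b \<Rightarrow> complex"
  assumes "\<And>a. a \<in> A \<Longrightarrow> (\<lambda>b. norm (f (a, b))) summable_on S"
    and "\<And>a. a \<in> A \<Longrightarrow> (\<Sum>\<^sub>\<infinity>b\<in>S. norm (f (a, b))) \<le> K * g a" and "g summable_on A"
  shows "f abs_summable_on A \<times> S"
proof (rule Infinite_Sum.abs_summable_on_Sigma_iff[THEN iffD2], intro conjI ballI)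
  show "(\<lambda>b. norm (f (a, b))) summable_on S" if "a \<in> A" for a
    using that by (rule assms(1))
  show "(\<lambda>a. norm (\<Sum>\<^sub>\<infinity>b\<in>S. norm (f (a, b)))) summable_on A"
  proof (rule summable_on_comparison_test)
    show "(\<lambda>a. K * g a) summable_on A" by (rule summable_on_cmult_right[OF assms(3)])
    have nn: "0 \<le> (\<Sum>\<^sub>\<infinity>b\<in>S. norm (f (a, b)))" for a by (rule infsum_nonneg) simp
    show "norm (\<Sum>\<^sub>\<infinity>b\<in>S. norm (f (a, b))) \<le> K * g a" if "a \<in> A" for a
      using assms(2)[OF that] nn[of a] by simp
  qed (rule norm_ge_zero)
qed

text \<open>Primal means the space of the polytope, where vectors are measured by the inverse of
  \<open>B\<close>; \<open>dual_term\<close> lives on the space of the linear functionals w,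
  measured by \<open>B\<close> itself. This is why \<open>dual_form\<close> occurs on the primal
  side.\<close>

definition primal_term :: "nat \<Rightarrow> ((nat \<Rightarrow> real) \<Rightarrow> (nat \<Rightarrow> real) \<Rightarrow> real) \<Rightarrow> (nat \<Rightarrow> real) \<Rightarrow> (nat \<Rightarrow> real) \<Rightarrow> (nat \<Rightarrow> real) \<Rightarrow> complex" where
  "primal_term n B t y z = of_real (exp (- pi * dual_form n B (ip n (z + t)))) * cis (2 * pi * ip n y z)"

definition dual_term :: "nat \<Rightarrow> ((nat \<Rightarrow> real) \<Rightarrow> (nat \<Rightarrow> real) \<Rightarrow> real) \<Rightarrow> (nat \<Rightarrow> real) \<Rightarrow> (nat \<Rightarrow> real) \<Rightarrow> (nat \<Rightarrow> real) \<Rightarrow> complex" where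
  "dual_term n B t y w = of_real (exp (- pi * B (w - y) (w - y))) * cis (2 * pi * ip n (w - y) t)"

lemma norm_primal_term: "norm (primal_term n B t y z) = exp (- pi * dual_form n B (ip n (z + t)))"
  and norm_dual_term: "norm (dual_term n B t y w) = exp (- pi * B (w - y) (w - y))"
  by (simp_all add: primal_term_def dual_term_def norm_mult)

text \<open>Splitting off the last coordinate k, the inverse form becomes that of R^n plus a square
  (k + T z)^2 / s with a shift affine in z. The one-variable formula replaces k by m and the shift
  by a phase, which only moves the frequency from \<open>y0\<close> to \<open>yy m\<close>, so the
  induction hypothesis applies for each m. The constant is built up as the root of the determinant,
  but what matters is that it is independent of \<open>t\<close> and \<open>y\<close>.\<close>

lemma poisson_summation_gaussian:
  assumes B: "sym_form B" and "pos_def_on n B"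
  shows "\<exists>C>0. \<forall>t y. in_Rd n y \<longrightarrow>
     primal_term n B t y abs_summable_on lattice n \<and> dual_term n B t y abs_summable_on lattice n \<and>
     infsum (primal_term n B t y) (lattice n) = of_real C * infsum (dual_term n B t y) (lattice n)"
  using assms(2)
proof (induction n)
  case 0
  have y: "y = 0" if "in_Rd 0 y" for y using that by (auto simp: in_Rd_def fun_eq_iff)
  show ?case
  proof (intro exI[of _ 1] conjI allI impI)
    fix t y :: "nat \<Rightarrow> real" assume "in_Rd 0 y"
    then have "y = 0" by (rule y)
    then show "infsum (primal_term 0 B t y) (lattice 0) = of_real 1 * infsum (dual_term 0 B t y) (lattice 0)"
      by (simp add: lattice_0 primal_term_def dual_term_def dual_form_0[OF linear_ip B] ip_def sym_form_simps[OF B])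
  qed (simp_all add: lattice_0)
next
  case (Suc n)
  note pd = pos_def_on_SucD[OF Suc.prems]
  obtain C where C: "C > 0" and IH: "\<And>t y. in_Rd n y \<Longrightarrow> primal_term n B t y abs_summable_on lattice n"
      "\<And>t y. in_Rd n y \<Longrightarrow> dual_term n B t y abs_summable_on lattice n"
      "\<And>t y. in_Rd n y \<Longrightarrow> infsum (primal_term n B t y) (lattice n) = of_real C * infsum (dual_term n B t y) (lattice n)"
    using Suc.IH[OF pd] by blast
  define g where "g = gs_vec n B"
  define s where "s = B g g"
  have s: "s > 0" unfolding s_def g_def by (rule form_gs_vec_pos[OF B Suc.prems])
  have g: "in_Rd (Suc n) g" "g n = 1" "\<And>w. in_Rd n w \<Longrightarrow> B g w = 0" "\<And>w. in_Rd n w \<Longrightarrow> B w g = 0"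
    unfolding g_def using in_Rd_gs_vec[OF B pd] gs_vec_last[OF B pd] form_gs_vec_left[OF B pd] form_gs_vec_right[OF B pd] by auto
  define g0 where "g0 = g(n := 0)"
  have g0: "in_Rd n g0" unfolding g0_def using g(1) by auto
  have ipg: "ip n x g0 = ip n x g" "ip n g0 x = ip n g x" for x by (auto simp: g0_def intro!: ip_cong)

  have Q: "dual_form (Suc n) B (ip (Suc n) (z(n := real_of_int k) + t))
     = dual_form n B (ip n (z + t)) + 1 / s * (k + (t n + ip n (z + t) g))\<^sup>2" for z t and k :: int
  proof -
    have "dual_form n B (ip (Suc n) (z(n := real_of_int k) + t)) = dual_form n B (ip n (z + t))"
      by (rule dual_form_cong) (auto simp: ip_Suc in_Rd_def intro!: ip_cong)
    moreover have "ip (Suc n) (z(n := real_of_int k) + t) g = k + (t n + ip n (z + t) g)"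
      using g(2) by (auto simp: ip_Suc intro!: ip_cong)
    ultimately show ?thesis
      using dual_form_Suc[OF B Suc.prems linear_ip[of "Suc n" "z(n := real_of_int k) + t"]]
      by (simp add: g_def[symmetric] s_def)
  qed

  show ?case
  proof (intro exI[of _ "C * sqrt s"] conjI allI impI)
    show "C * sqrt s > 0" using C s by simp
    fix t y :: "nat \<Rightarrow> real" assume y: "in_Rd (Suc n) y"
    define T where "T z = t n + ip n (z + t) g" for z
    define y0 where "y0 = y(n := 0)"
    have y0: "in_Rd n y0" unfolding y0_def using y by auto
    \<comment> \<open>Chosen so that a lattice point over w with last coordinate m, minus y, splits
      orthogonally as (w - \<open>yy m\<close>) + (m - y n) g. The same vector is the new frequency
      once the phase coming from \<open>T z\<close> is absorbed.\<close>
    define yy where "yy m = y0 + (real_of_int m - y n) *\<^sub>R g0" for m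
    have yy: "in_Rd n (yy m)" for m unfolding yy_def using y0 g0 by auto
    have e0: "in_Rd n 0" by simp

    have ipy: "ip (Suc n) y (z(n := real_of_int k)) = ip n y0 z + y n * k" for z k
      by (auto simp: ip_Suc y0_def intro!: ip_cong)

    have P: "primal_term (Suc n) B t y (z(n := real_of_int k))
        = primal_term n B t y0 z * (of_real (exp (- pi * (1 / s) * (k + T z)\<^sup>2)) * cis (2 * pi * y n * k))" for z k
    proof -
      have e1: "exp (- pi * (a + 1 / s * b)) = exp (- pi * a) * exp (- pi * (1 / s) * b)" for a b
        by (simp add: exp_add[symmetric] algebra_simps)
      have e2: "cis (2 * pi * (a + y n * k)) = cis (2 * pi * a) * cis (2 * pi * y n * k)" for a
        by (simp add: cis_mult algebra_simps)
      show ?thesis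
        unfolding primal_term_def Q ipy T_def[symmetric] e1 e2 of_real_mult by (simp only: ac_simps)
    qed

    obtain K where K: "\<And>t. (\<Sum>\<^sub>\<infinity>k::int. exp (- (pi * (1/s)) * (k + t)\<^sup>2)) \<le> K"
      using infsum_gaussian_int_bounded[of "pi * (1/s)"] s by auto
    have pis: "pi * (1/s) > 0" using s by simp

    define F where "F = (\<lambda>(z, k). primal_term (Suc n) B t y (z(n := real_of_int k)))"
    have nF: "norm (F (z, k)) = norm (primal_term n B t y0 z) * exp (- (pi * (1/s)) * (k + T z)\<^sup>2)" for z k
      unfolding F_def by (simp add: P norm_mult)
    have sumF: "F abs_summable_on lattice n \<times> UNIV"
    proof (rule abs_summable_on_TimesI[where g = "\<lambda>z. norm (primal_term n B t y0 z)" and K = K])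
      show "(\<lambda>k. norm (F (z, k))) summable_on UNIV" for z
        unfolding nF by (intro summable_on_cmult_right summable_gaussian_int pis)
      show "(\<Sum>\<^sub>\<infinity>k. norm (F (z, k))) \<le> K * norm (primal_term n B t y0 z)" for z
        unfolding nF infsum_cmult_right' using mult_left_mono[OF K[of "T z"] norm_ge_zero] by (simp add: mult.commute)
    qed (rule IH(1)[OF y0])
    show "primal_term (Suc n) B t y abs_summable_on lattice (Suc n)"
      using sumF summable_on_reindex_bij_betw[OF bij_betw_lattice_Suc, of "\<lambda>z. norm (primal_term (Suc n) B t y z)" n]
      by (simp add: F_def case_prod_unfold)

    have D: "dual_term (Suc n) B t y (w(n := real_of_int m)) = 
       of_real (exp (- pi * s * (m - y n)\<^sup>2)) * cis (2 * pi * (m - y n) * (t n + ip n t g)) * dual_term n B t (yy m) w"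
      if "w \<in> lattice n" for w m
    proof -
      have w: "in_Rd n w" using that by (simp add: lattice_pt_def)
      define u where "u = w - yy m"
      have u: "in_Rd n u" unfolding u_def using w yy by auto
      have eq: "w(n := real_of_int m) - y = u + (m - y n) *\<^sub>R g"
        using w g(2) by (auto simp: fun_eq_iff u_def yy_def y0_def g0_def in_Rd_def)
      have "B (w(n := real_of_int m) - y) (w(n := real_of_int m) - y) = B u u + s * (m - y n)\<^sup>2"
        unfolding eq using g(3)[OF u] g(4)[OF u] by (simp add: sym_form_simps[OF B] s_def power2_eq_square)
      moreover have "ip (Suc n) (w(n := real_of_int m) - y) t = ip n u t + (m - y n) * (t n + ip n t g)"
        unfolding eq using u g(2) by (simp add: ip_Suc ip_simps in_Rd_def ip_commute[of n g t] algebra_simps)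
      moreover have "exp (- pi * (B u u + s * (m - y n)\<^sup>2)) = exp (- pi * s * (m - y n)\<^sup>2) * exp (- pi * B u u)"
        by (simp add: exp_add[symmetric] algebra_simps)
      moreover have "cis (2 * pi * (ip n u t + (m - y n) * (t n + ip n t g))) = cis (2 * pi * (m - y n) * (t n + ip n t g)) * cis (2 * pi * ip n u t)"
        by (simp add: cis_mult algebra_simps)
      ultimately show ?thesis
        unfolding dual_term_def u_def[symmetric] by (simp only: of_real_mult ac_simps)
    qed

    \<comment> \<open>Summing over m needs a bound uniform in the shift. The induction hypothesis
      supplies it: a shifted dual sum is a primal sum with phases, and dropping the phases gives the
      unshifted one.\<close>
    have bnd: "(\<Sum>\<^sub>\<infinity>w\<in>lattice n. norm (dual_term n B t z w)) \<le> (\<Sum>\<^sub>\<infinity>w\<in>lattice n. norm (dual_term n B 0 0 w))" 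
      if z: "in_Rd n z" for z
    proof -
      have r: "dual_term n B 0 z = (\<lambda>w. of_real (norm (dual_term n B t z w)))"
        unfolding norm_dual_term by (simp add: dual_term_def ip_simps fun_eq_iff)
      have "of_real C * complex_of_real (\<Sum>\<^sub>\<infinity>w\<in>lattice n. norm (dual_term n B t z w)) = infsum (primal_term n B 0 z) (lattice n)"
        unfolding IH(3)[OF z] r infsum_complex_of_real ..
      then have "C * (\<Sum>\<^sub>\<infinity>w\<in>lattice n. norm (dual_term n B t z w)) = norm (infsum (primal_term n B 0 z) (lattice n))"
        using C infsum_nonneg[of "lattice n" "\<lambda>w. norm (dual_term n B t z w)"]
        by (simp add: norm_mult flip: \<open>of_real C * _ = _\<close>)
      also have "\<dots> \<le> (\<Sum>\<^sub>\<infinity>w\<in>lattice n. norm (primal_term n B 0 z w))"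
        by (rule norm_infsum_bound[OF IH(1)[OF z]])
      also have "\<dots> = norm (infsum (primal_term n B 0 0) (lattice n))"
      proof -
        have r': "primal_term n B 0 0 = (\<lambda>w. of_real (norm (primal_term n B 0 z w)))"
          unfolding norm_primal_term by (simp add: primal_term_def ip_simps fun_eq_iff)
        show ?thesis unfolding r' infsum_complex_of_real
          using infsum_nonneg[of "lattice n" "\<lambda>w. norm (primal_term n B 0 z w)"] by simp
      qed
      also have "\<dots> = C * norm (infsum (dual_term n B 0 0) (lattice n))"
        unfolding IH(3)[OF e0] using C by (simp add: norm_mult)
      also have "\<dots> \<le> C * (\<Sum>\<^sub>\<infinity>w\<in>lattice n. norm (dual_term n B 0 0 w))"
        using C norm_infsum_bound[OF IH(2)[OF e0]] by (intro mult_left_mono) auto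
      finally show ?thesis using C by simp
    qed

    define G where "G = (\<lambda>(m::int, w). dual_term (Suc n) B t y (w(n := real_of_int m)))"
    have nG: "norm (G (m, w)) = exp (- (pi * s) * (m + - y n)\<^sup>2) * norm (dual_term n B t (yy m) w)" if "w \<in> lattice n" for m w
      unfolding G_def using D[OF that] by (simp add: norm_mult)
    have pis': "pi * s > 0" using s by simp
    have sumG: "G abs_summable_on UNIV \<times> lattice n"
    proof (rule abs_summable_on_TimesI[where g = "\<lambda>m::int. exp (- (pi * s) * (m + - y n)\<^sup>2)" and K = "\<Sum>\<^sub>\<infinity>w\<in>lattice n. norm (dual_term n B 0 0 w)"])
      show "(\<lambda>w. norm (G (m, w))) summable_on lattice n" for m
      proof -
        have "(\<lambda>w. exp (- (pi * s) * (m + - y n)\<^sup>2) * norm (dual_term n B t (yy m) w)) summable_on lattice n"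
          by (rule summable_on_cmult_right[OF IH(2)[OF yy]])
        then show ?thesis by (rule summable_on_cong[THEN iffD2, rotated]) (rule nG)
      qed
      fix m
      have "(\<Sum>\<^sub>\<infinity>w\<in>lattice n. norm (G (m, w))) = exp (- (pi * s) * (m + - y n)\<^sup>2) * (\<Sum>\<^sub>\<infinity>w\<in>lattice n. norm (dual_term n B t (yy m) w))"
        unfolding infsum_cmult_right'[symmetric] by (intro infsum_cong nG)
      also have "\<dots> \<le> exp (- (pi * s) * (m + - y n)\<^sup>2) * (\<Sum>\<^sub>\<infinity>w\<in>lattice n. norm (dual_term n B 0 0 w))"
        by (intro mult_left_mono bnd[OF yy]) auto
      finally show "(\<Sum>\<^sub>\<infinity>w\<in>lattice n. norm (G (m, w))) \<le> (\<Sum>\<^sub>\<infinity>w\<in>lattice n. norm (dual_term n B 0 0 w)) * exp (- (pi * s) * (m + - y n)\<^sup>2)"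
        by (simp add: mult.commute)
    qed (rule summable_gaussian_int[OF pis'])

    have bij2: "bij_betw (\<lambda>(m, w). w(n := real_of_int m)) (UNIV \<times> lattice n) (lattice (Suc n))"
    proof -
      have "bij_betw prod.swap (UNIV \<times> lattice n) (lattice n \<times> (UNIV :: int set))"
        by (rule bij_betw_byWitness[where f' = prod.swap]) auto
      from bij_betw_trans[OF this bij_betw_lattice_Suc[of n]] show ?thesis
        by (simp add: o_def case_prod_unfold)
    qed
    show "dual_term (Suc n) B t y abs_summable_on lattice (Suc n)"
      using sumG summable_on_reindex_bij_betw[OF bij2, of "\<lambda>z. norm (dual_term (Suc n) B t y z)"]
      by (simp add: G_def case_prod_unfold)

    \<comment> \<open>The double sum after transforming the last coordinate only. Its absolute
      convergence permits exchanging the order, which puts the sum over z inside, where the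
      induction hypothesis acts.\<close>
    define h where "h = (\<lambda>z (m::int). primal_term n B t y0 z * (of_real (exp (- pi * s * (m - y n)\<^sup>2)) * cis (2 * pi * (m - y n) * T z)))"
    have nh: "norm (h z m) = norm (primal_term n B t y0 z) * exp (- (pi * s) * (m + - y n)\<^sup>2)" for z m
      by (simp add: h_def norm_mult)
    have sumh: "(\<lambda>(z, m). h z m) summable_on lattice n \<times> UNIV"
    proof (rule abs_summable_summable, rule abs_summable_on_TimesI[where g = "\<lambda>z. norm (primal_term n B t y0 z)"
          and K = "\<Sum>\<^sub>\<infinity>m::int. exp (- (pi * s) * (m + - y n)\<^sup>2)"])
      show "(\<lambda>m. norm (case (z, m) of (z, m) \<Rightarrow> h z m)) summable_on UNIV" for z
        unfolding prod.case nh by (intro summable_on_cmult_right summable_gaussian_int pis')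
      show "(\<Sum>\<^sub>\<infinity>m. norm (case (z, m) of (z, m) \<Rightarrow> h z m)) \<le> (\<Sum>\<^sub>\<infinity>m::int. exp (- (pi * s) * (m + - y n)\<^sup>2)) * norm (primal_term n B t y0 z)" for z
        unfolding prod.case nh infsum_cmult_right' by (simp add: mult.commute)
    qed (rule IH(1)[OF y0])

    have hm: "(\<Sum>\<^sub>\<infinity>z\<in>lattice n. h z m) = of_real C * (\<Sum>\<^sub>\<infinity>w\<in>lattice n. G (m, w))" for m
    proof -
      define c where "c = of_real (exp (- pi * s * (m - y n)\<^sup>2)) * cis (2 * pi * (m - y n) * (t n + ip n t g))"
      have hc: "h z m = c * primal_term n B t (yy m) z" for z
      proof -
        have i1: "ip n (yy m) z = ip n y0 z + (m - y n) * ip n z g"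
          using ipg(2)[of z] by (simp add: yy_def ip_simps ip_commute[of n g z])
        have i2: "T z = (t n + ip n t g) + ip n z g" by (simp add: T_def ip_simps)
        have "cis (2 * pi * ip n y0 z) * cis (2 * pi * (m - y n) * T z)
            = cis (2 * pi * (m - y n) * (t n + ip n t g)) * cis (2 * pi * ip n (yy m) z)"
          unfolding i1 i2 cis_mult by (simp add: algebra_simps)
        then show ?thesis
          unfolding h_def c_def primal_term_def by (simp only: mult.assoc mult.left_commute mult.commute[of "cis _" "of_real _"])
      qed
      have "(\<Sum>\<^sub>\<infinity>z\<in>lattice n. h z m) = c * (of_real C * (\<Sum>\<^sub>\<infinity>w\<in>lattice n. dual_term n B t (yy m) w))"
        unfolding hc infsum_cmult_right' IH(3)[OF yy] ..
      also have "\<dots> = of_real C * (\<Sum>\<^sub>\<infinity>w\<in>lattice n. c * dual_term n B t (yy m) w)"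
        by (simp add: infsum_cmult_right')
      also have "(\<Sum>\<^sub>\<infinity>w\<in>lattice n. c * dual_term n B t (yy m) w) = (\<Sum>\<^sub>\<infinity>w\<in>lattice n. G (m, w))"
        by (intro infsum_cong) (simp add: G_def D c_def)
      finally show ?thesis .
    qed

    have "infsum (primal_term (Suc n) B t y) (lattice (Suc n)) = infsum F (lattice n \<times> UNIV)"
      using infsum_reindex_bij_betw[OF bij_betw_lattice_Suc, of "primal_term (Suc n) B t y" n]
      by (simp add: F_def case_prod_unfold)
    also have "\<dots> = (\<Sum>\<^sub>\<infinity>z\<in>lattice n. \<Sum>\<^sub>\<infinity>k. F (z, k))"
      using infsum_Sigma_banach[OF abs_summable_summable[OF sumF]] by simp
    also have "\<dots> = (\<Sum>\<^sub>\<infinity>z\<in>lattice n. of_real (sqrt s) * (\<Sum>\<^sub>\<infinity>m. h z m))"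
    proof (rule infsum_cong)
      fix z
      have a: "1 / s > 0" using s by simp
      have "(\<Sum>\<^sub>\<infinity>k. F (z, k)) = primal_term n B t y0 z * (\<Sum>\<^sub>\<infinity>k::int. of_real (exp (- pi * (1 / s) * (k + T z)\<^sup>2)) * cis (2 * pi * y n * k))"
        unfolding F_def prod.case P infsum_cmult_right' ..
      also have "\<dots> = primal_term n B t y0 z * (of_real (1 / sqrt (1 / s)) *
           (\<Sum>\<^sub>\<infinity>m::int. of_real (exp (- pi * (m - y n)\<^sup>2 / (1 / s))) * cis (2 * pi * (m - y n) * T z)))"
        unfolding poisson_summation_gaussian_int[OF a] ..
      also have "\<dots> = of_real (sqrt s) * (\<Sum>\<^sub>\<infinity>m. h z m)"
        unfolding h_def infsum_cmult_right' using s by (simp add: real_sqrt_divide mult.commute[of _ s] mult.assoc mult.left_commute)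
      finally show "(\<Sum>\<^sub>\<infinity>k. F (z, k)) = of_real (sqrt s) * (\<Sum>\<^sub>\<infinity>m. h z m)" .
    qed
    also have "\<dots> = of_real (sqrt s) * (\<Sum>\<^sub>\<infinity>m. \<Sum>\<^sub>\<infinity>z\<in>lattice n. h z m)"
      unfolding infsum_cmult_right' infsum_swap_banach[OF sumh] ..
    also have "\<dots> = of_real (C * sqrt s) * (\<Sum>\<^sub>\<infinity>m. \<Sum>\<^sub>\<infinity>w\<in>lattice n. G (m, w))"
      unfolding hm infsum_cmult_right' by simp
    also have "(\<Sum>\<^sub>\<infinity>m. \<Sum>\<^sub>\<infinity>w\<in>lattice n. G (m, w)) = infsum G (UNIV \<times> lattice n)"
      using infsum_Sigma_banach[OF abs_summable_summable[OF sumG]] by simp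
    also have "\<dots> = infsum (dual_term (Suc n) B t y) (lattice (Suc n))"
      using infsum_reindex_bij_betw[OF bij2, of "dual_term (Suc n) B t y"] by (simp add: G_def case_prod_unfold)
    finally show "infsum (primal_term (Suc n) B t y) (lattice (Suc n)) = of_real (C * sqrt s) * infsum (dual_term (Suc n) B t y) (lattice (Suc n))" .
  qed
qed

definition primal_theta :: "nat \<Rightarrow> ((nat \<Rightarrow> real) \<Rightarrow> (nat \<Rightarrow> real) \<Rightarrow> real) \<Rightarrow> (nat \<Rightarrow> real) \<Rightarrow> real" where
  "primal_theta n B t = (\<Sum>\<^sub>\<infinity>z\<in>lattice n. exp (- pi * dual_form n B (ip n (z + t))))"

definition dual_theta :: "nat \<Rightarrow> ((nat \<Rightarrow> real) \<Rightarrow> (nat \<Rightarrow> real) \<Rightarrow> real) \<Rightarrow> (nat \<Rightarrow> real) \<Rightarrow> real" where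
  "dual_theta n B y = (\<Sum>\<^sub>\<infinity>w\<in>lattice n. exp (- pi * B (w - y) (w - y)))"

text \<open>On one side of the Poisson formula a shift acts as a phase. Bounding a sum with phases
  by its moduli shows that shifting cannot increase either theta sum. Isolating the term 1 at w = 0
  bounds the real part from below by 1 - (\<open>dual_theta n B 0\<close> - 1), which is the last
  estimate: if the dual sum is close to 1, the primal sum hardly depends on the shift.\<close>

lemma theta_duality:
  assumes B: "sym_form B" and pd: "pos_def_on n B"
  obtains C where "C > 0"
    "\<And>t. (\<lambda>z. exp (- pi * dual_form n B (ip n (z + t)))) summable_on lattice n"
    "\<And>y. in_Rd n y \<Longrightarrow> (\<lambda>w. exp (- pi * B (w - y) (w - y))) summable_on lattice n"
    "\<And>t. primal_theta n B t \<le> primal_theta n B 0"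
    "\<And>y. in_Rd n y \<Longrightarrow> dual_theta n B y \<le> dual_theta n B 0"
    "primal_theta n B 0 = C * dual_theta n B 0"
    "\<And>t. C * (2 - dual_theta n B 0) \<le> primal_theta n B t"
proof -
  obtain C where C: "C > 0" and P: "\<And>t y. in_Rd n y \<Longrightarrow> primal_term n B t y abs_summable_on lattice n"
      "\<And>t y. in_Rd n y \<Longrightarrow> dual_term n B t y abs_summable_on lattice n"
      "\<And>t y. in_Rd n y \<Longrightarrow> infsum (primal_term n B t y) (lattice n) = of_real C * infsum (dual_term n B t y) (lattice n)"
    using poisson_summation_gaussian[OF B pd] by blast
  have e0: "in_Rd n 0" by simp
  have sp: "(\<lambda>z. exp (- pi * dual_form n B (ip n (z + t)))) summable_on lattice n" for t
    using P(1)[OF e0, of t] unfolding norm_primal_term .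
  have sd: "(\<lambda>w. exp (- pi * B (w - y) (w - y))) summable_on lattice n" if "in_Rd n y" for y
    using P(2)[OF that, of 0] unfolding norm_dual_term .
  have p0: "infsum (primal_term n B t 0) (lattice n) = of_real (primal_theta n B t)" for t
    unfolding primal_theta_def primal_term_def by (simp add: ip_simps infsum_complex_of_real[symmetric])
  have d0: "infsum (dual_term n B 0 y) (lattice n) = of_real (dual_theta n B y)" for y
    unfolding dual_theta_def dual_term_def by (simp add: ip_simps infsum_complex_of_real[symmetric])
  have pn: "(\<Sum>\<^sub>\<infinity>z\<in>lattice n. norm (primal_term n B t y z)) = primal_theta n B t" for t y
    unfolding primal_theta_def norm_primal_term ..
  have dn: "(\<Sum>\<^sub>\<infinity>z\<in>lattice n. norm (dual_term n B t y z)) = dual_theta n B y" for t y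
    unfolding dual_theta_def norm_dual_term ..
  have nn: "primal_theta n B t \<ge> 0" "dual_theta n B y \<ge> 0" for t y
    unfolding primal_theta_def dual_theta_def by (auto intro!: infsum_nonneg)
  have eq: "primal_theta n B 0 = C * dual_theta n B 0"
    using P(3)[OF e0, of 0] unfolding p0 d0 of_real_mult[symmetric] of_real_eq_iff .
  have ple: "primal_theta n B t \<le> primal_theta n B 0" for t
  proof -
    have "primal_theta n B t = norm (infsum (primal_term n B t 0) (lattice n))" using nn(1)[of t] by (simp add: p0)
    also have "\<dots> = C * norm (infsum (dual_term n B t 0) (lattice n))" unfolding P(3)[OF e0] using C by (simp add: norm_mult)
    also have "\<dots> \<le> C * dual_theta n B 0"
      using norm_infsum_bound[OF P(2)[OF e0, of t]] C unfolding dn by (intro mult_left_mono) auto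
    finally show ?thesis by (simp add: eq)
  qed
  have dle: "dual_theta n B y \<le> dual_theta n B 0" if y: "in_Rd n y" for y
  proof -
    have "C * dual_theta n B y = norm (of_real C * infsum (dual_term n B 0 y) (lattice n))"
      using nn(2)[of y] C by (simp add: d0 norm_mult)
    also have "\<dots> = norm (infsum (primal_term n B 0 y) (lattice n))" unfolding P(3)[OF y] ..
    also have "\<dots> \<le> primal_theta n B 0" using norm_infsum_bound[OF P(1)[OF y, of 0]] unfolding pn .
    finally show ?thesis using C by (simp add: eq)
  qed
  have low: "C * (2 - dual_theta n B 0) \<le> primal_theta n B t" for t
  proof -
    define R where "R = lattice n - {0}"
    have l0: "0 \<in> lattice n" by (simp add: lattice_pt_def)
    have ins: "lattice n = insert 0 R" "0 \<notin> R" using l0 by (auto simp: R_def)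
    have RsD: "dual_term n B t 0 abs_summable_on R"
      using P(2)[OF e0, of t] by (rule summable_on_subset_banach) (auto simp: R_def)
    have s1: "infsum (dual_term n B t 0) (lattice n) = 1 + infsum (dual_term n B t 0) R"
      unfolding ins(1) infsum_insert[OF abs_summable_summable[OF RsD] ins(2)]
      by (simp add: dual_term_def ip_simps sym_form_simps[OF B])
    have s2: "dual_theta n B 0 = 1 + (\<Sum>\<^sub>\<infinity>w\<in>R. norm (dual_term n B t 0 w))"
      unfolding dn[of t 0, symmetric] ins(1) infsum_insert[OF RsD ins(2)]
      by (simp add: norm_dual_term sym_form_simps[OF B])
    have "norm (infsum (dual_term n B t 0) R) \<le> dual_theta n B 0 - 1"
      using norm_infsum_bound[OF RsD] s2 by simp
    then have "2 - dual_theta n B 0 \<le> Re (infsum (dual_term n B t 0) (lattice n))"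
      unfolding s1 using abs_Re_le_cmod[of "infsum (dual_term n B t 0) R"] by simp
    then have "C * (2 - dual_theta n B 0) \<le> C * Re (infsum (dual_term n B t 0) (lattice n))"
      using C by (intro mult_left_mono) auto
    also have "\<dots> = Re (infsum (primal_term n B t 0) (lattice n))" unfolding P(3)[OF e0] by simp
    also have "\<dots> = primal_theta n B t" by (simp add: p0)
    finally show ?thesis .
  qed
  show ?thesis by (rule that[OF C sp sd ple dle eq low])
qed

subsection \<open>Gaussian tails\<close>

lemma has_sum_finite_sum:
  fixes f :: "'i \<Rightarrow> 'a \<Rightarrow> real"
  assumes "finite I" "\<And>i. i \<in> I \<Longrightarrow> (f i has_sum s i) A"
  shows "((\<lambda>x. \<Sum>i\<in>I. f i x) has_sum (\<Sum>i\<in>I. s i)) A"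
  using assms by (induction I rule: finite_induct) (auto intro!: has_sum_add)

text \<open>On the half space, translating by l \<mu> changes the exponent B x x by at most - 2 l W
  + l^2 A, and l = W / A minimises this bound, with value - W^2 / A.\<close>

lemma gaussian_tail_pointwise:
  assumes B: "sym_form B" and A: "A > 0" "B \<mu> \<mu> \<le> A" and W: "0 \<le> W" "W \<le> B x \<mu>"
  shows "exp (- pi * B x x) \<le> exp (- pi * W\<^sup>2 / A) * exp (- pi * B (x - (W / A) *\<^sub>R \<mu>) (x - (W / A) *\<^sub>R \<mu>))"
proof -
  define l where "l = W / A"
  have l: "l \<ge> 0" using A W by (simp add: l_def)
  have "B (x - l *\<^sub>R \<mu>) (x - l *\<^sub>R \<mu>) = B x x - 2 * l * B x \<mu> + l\<^sup>2 * B \<mu> \<mu>"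
    by (simp add: sym_form_simps[OF B] sym_form_commute[OF B, of \<mu> x] power2_eq_square algebra_simps)
  also have "\<dots> \<le> B x x - 2 * l * W + l\<^sup>2 * A"
    using l W A by (intro add_mono diff_mono mult_left_mono) auto
  also have "\<dots> = B x x - W\<^sup>2 / A"
    using A by (simp add: l_def power2_eq_square field_simps)
  finally have "pi * (B (x - l *\<^sub>R \<mu>) (x - l *\<^sub>R \<mu>) + W\<^sup>2 / A) \<le> pi * B x x"
    by (intro mult_left_mono) auto
  then show ?thesis by (simp add: exp_add[symmetric] l_def[symmetric] algebra_simps)
qed

text \<open>Union bound: a nonzero w lies in the half space of some v or in its mirror image, and is
  charged to the Gaussian translated in that direction; each translate sums to at most the unshifted
  value. The summand 1 is the term w = 0, the factor 2 stands for the two signs.\<close>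

lemma dual_theta_le_of_cover:
  assumes B: "sym_form B" "pos_def_on n B" and V: "finite V" and lin: "\<And>v. v \<in> V \<Longrightarrow> linear (F v)"
    and A: "A > 0" "\<And>v. v \<in> V \<Longrightarrow> dual_form n B (F v) \<le> A" and W: "W \<ge> 0"
    and cover: "\<And>w. w \<in> lattice n \<Longrightarrow> w \<noteq> 0 \<Longrightarrow> \<exists>v\<in>V. W \<le> \<bar>F v w\<bar>"
  shows "dual_theta n B 0 \<le> 1 + 2 * card V * exp (- pi * W\<^sup>2 / A) * dual_theta n B 0"
proof -
  obtain C where sd: "\<And>y. in_Rd n y \<Longrightarrow> (\<lambda>w. exp (- pi * B (w - y) (w - y))) summable_on lattice n"
    and dle: "\<And>y. in_Rd n y \<Longrightarrow> dual_theta n B y \<le> dual_theta n B 0"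
    using theta_duality[OF B] by metis
  define E where "E = exp (- pi * W\<^sup>2 / A)"
  define m where "m v = (W / A) *\<^sub>R riesz n B (F v)" for v
  have m: "in_Rd n (m v)" "in_Rd n (0 - m v)" if "v \<in> V" for v
    unfolding m_def by (intro in_Rd_diff in_Rd_0 in_Rd_scaleR in_Rd_riesz[OF B lin[OF that]])+
  define T where "T w y = exp (- pi * B (w - y) (w - y))" for w y
  have pt: "T w 0 \<le> (\<Sum>v\<in>V. E * (T w (m v) + T w (0 - m v)))" if w: "w \<in> lattice n" "w \<noteq> 0" for w
  proof -
    obtain v where v: "v \<in> V" "W \<le> \<bar>F v w\<bar>" using cover[OF w] by blast
    have rw: "in_Rd n w" using w by (simp add: lattice_pt_def)
    have Fv: "B w (riesz n B (F v)) = F v w"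
      using form_riesz[OF B lin[OF v(1)] rw] sym_form_commute[OF B(1)] by simp
    have \<mu>A: "B (riesz n B (F v)) (riesz n B (F v)) \<le> A" using A(2)[OF v(1)] by (simp add: dual_form_def)
    have "T w 0 \<le> E * (T w (m v) + T w (0 - m v))"
    proof (cases "F v w \<ge> 0")
      case True
      then have "W \<le> B w (riesz n B (F v))" using v Fv by simp
      from gaussian_tail_pointwise[OF B(1) A(1) \<mu>A W this]
      have "T w 0 \<le> E * T w (m v)" unfolding T_def E_def m_def diff_zero .
      moreover have "0 \<le> E * T w (0 - m v)" by (simp add: E_def T_def)
      ultimately show ?thesis by (simp add: distrib_left)
    next
      case False
      have "B (0 - w) (riesz n B (F v)) = - F v w" using Fv by (simp add: sym_form_simps[OF B(1)])
      then have "W \<le> B (0 - w) (riesz n B (F v))" using False v by simp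
      note tail = gaussian_tail_pointwise[OF B(1) A(1) \<mu>A W this, folded m_def]
      have "B (0 - w) (0 - w) = B (w - 0) (w - 0)"
        "B (0 - w - m v) (0 - w - m v) = B (w - (0 - m v)) (w - (0 - m v))"
        by (simp_all add: sym_form_simps[OF B(1)])
      then have "T w 0 \<le> E * T w (0 - m v)" using tail unfolding T_def E_def by (simp only:)
      moreover have "0 \<le> E * T w (m v)" by (simp add: E_def T_def)
      ultimately show ?thesis by (simp add: distrib_left)
    qed
    also have "\<dots> \<le> (\<Sum>v\<in>V. E * (T w (m v) + T w (0 - m v)))"
      using V v(1) by (intro member_le_sum[where f = "\<lambda>v. E * (T w (m v) + T w (0 - m v))"]) (auto simp: E_def T_def)
    finally show ?thesis .
  qed
  have hs: "((\<lambda>w. T w y) has_sum dual_theta n B y) (lattice n)" if "in_Rd n y" for y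
    unfolding T_def dual_theta_def using sd[OF that] by (rule has_sum_infsum)
  have "((\<lambda>w. \<Sum>v\<in>V. E * (T w (m v) + T w (0 - m v))) has_sum
      (\<Sum>v\<in>V. E * (dual_theta n B (m v) + dual_theta n B (0 - m v)))) (lattice n)"
    using V m by (intro has_sum_finite_sum has_sum_cmult_right has_sum_add hs) auto
  moreover have "((\<lambda>w. if w = 0 then 1 else 0 :: real) has_sum 1) (lattice n)"
    using has_sum_cong_neutral[of "{0}" "lattice n" "\<lambda>w. if w = 0 then 1 else 0 :: real" "\<lambda>w. if w = 0 then 1 else 0" 1]
      has_sum_finite[of "{0::nat \<Rightarrow> real}" "\<lambda>w. if w = 0 then 1 else 0 :: real"]
    by (auto simp: lattice_pt_def)
  ultimately have hR: "((\<lambda>w. (if w = 0 then 1 else 0) + (\<Sum>v\<in>V. E * (T w (m v) + T w (0 - m v)))) has_sum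
      (1 + (\<Sum>v\<in>V. E * (dual_theta n B (m v) + dual_theta n B (0 - m v))))) (lattice n)"
    by (intro has_sum_add)
  have nnS: "0 \<le> (\<Sum>v\<in>V. E * (T w (m v) + T w (0 - m v)))" for w
    by (intro sum_nonneg) (simp add: E_def T_def)
  have le1: "dual_theta n B 0 \<le> 1 + (\<Sum>v\<in>V. E * (dual_theta n B (m v) + dual_theta n B (0 - m v)))"
  proof (rule has_sum_mono[OF hs[OF in_Rd_0] hR])
    fix w assume "w \<in> lattice n"
    then show "T w 0 \<le> (if w = 0 then 1 else 0) + (\<Sum>v\<in>V. E * (T w (m v) + T w (0 - m v)))"
      using pt[of w] nnS[of 0] by (cases "w = 0") (auto simp: T_def sym_form_simps[OF B(1)])
  qed
  have le2: "(\<Sum>v\<in>V. E * (dual_theta n B (m v) + dual_theta n B (0 - m v))) \<le> (\<Sum>v\<in>V. E * (2 * dual_theta n B 0))"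
  proof (intro sum_mono mult_left_mono)
    fix v assume v: "v \<in> V"
    show "dual_theta n B (m v) + dual_theta n B (0 - m v) \<le> 2 * dual_theta n B 0"
      using dle[OF m(1)[OF v]] dle[OF m(2)[OF v]] by linarith
  qed (simp add: E_def)
  have "(\<Sum>v\<in>V. E * (2 * dual_theta n B 0)) = 2 * card V * E * dual_theta n B 0" by simp
  with le1 le2 show ?thesis unfolding E_def by linarith
qed

text \<open>One-sided half spaces, hence no factor 2. Moving the Riesz vector by (W / A) \<mu>,
  where \<mu> represents v, is the same as moving \<open>t\<close> by (W / A) v, so the translated
  Gaussian again sums to a value of \<open>primal_theta\<close>.\<close>

lemma primal_theta_le_of_cover:
  assumes B: "sym_form B" "pos_def_on n B" and V: "finite V"
    and A: "A > 0" "\<And>v. v \<in> V \<Longrightarrow> dual_form n B (ip n v) \<le> A" and W: "W \<ge> 0"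
    and cover: "\<And>z. z \<in> lattice n \<Longrightarrow> \<exists>v\<in>V. ip n v (riesz n B (ip n (z + t))) \<le> - W"
  shows "primal_theta n B t \<le> card V * exp (- pi * W\<^sup>2 / A) * primal_theta n B 0"
proof -
  obtain C where sp: "\<And>t. (\<lambda>z. exp (- pi * dual_form n B (ip n (z + t)))) summable_on lattice n"
    and ple: "\<And>t. primal_theta n B t \<le> primal_theta n B 0"
    using theta_duality[OF B] by metis
  define E where "E = exp (- pi * W\<^sup>2 / A)"
  define T where "T z t = exp (- pi * dual_form n B (ip n (z + t)))" for z t
  have hs: "((\<lambda>z. T z t) has_sum primal_theta n B t) (lattice n)" for t
    unfolding T_def primal_theta_def using sp by (rule has_sum_infsum)
  have pt: "T z t \<le> (\<Sum>v\<in>V. E * T z (t + (W / A) *\<^sub>R v))" if z: "z \<in> lattice n" for z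
  proof -
    define y where "y = riesz n B (ip n (z + t))"
    obtain v where v: "v \<in> V" "ip n v y \<le> - W" using cover[OF z] by (auto simp: y_def)
    define \<mu> where "\<mu> = riesz n B (ip n v)"
    have Ry: "in_Rd n y" "\<And>w. in_Rd n w \<Longrightarrow> B y w = ip n (z + t) w"
      unfolding y_def by (rule in_Rd_riesz[OF B linear_ip] form_riesz[OF B linear_ip], assumption?)+
    have R\<mu>: "in_Rd n \<mu>" "\<And>w. in_Rd n w \<Longrightarrow> B \<mu> w = ip n v w"
      unfolding \<mu>_def by (rule in_Rd_riesz[OF B linear_ip] form_riesz[OF B linear_ip], assumption?)+
    have "B (0 - y) \<mu> = - ip n v y"
      using R\<mu>(2)[OF Ry(1)] sym_form_commute[OF B(1), of y \<mu>] by (simp add: sym_form_simps[OF B(1)])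
    then have W': "W \<le> B (0 - y) \<mu>" using v by simp
    have \<mu>A: "B \<mu> \<mu> \<le> A" using A(2)[OF v(1)] by (simp add: dual_form_def \<mu>_def)
    have "riesz n B (ip n (z + (t + (W / A) *\<^sub>R v))) = y + (W / A) *\<^sub>R \<mu>"
      using Ry R\<mu> by (intro riesz_eqI[OF B linear_ip] in_Rd_add in_Rd_scaleR) (simp_all add: sym_form_simps[OF B(1)] ip_simps)
    then have "T z (t + (W / A) *\<^sub>R v) = exp (- pi * B (y + (W / A) *\<^sub>R \<mu>) (y + (W / A) *\<^sub>R \<mu>))"
      by (simp only: T_def dual_form_def)
    also have "B (y + (W / A) *\<^sub>R \<mu>) (y + (W / A) *\<^sub>R \<mu>) = B (0 - y - (W / A) *\<^sub>R \<mu>) (0 - y - (W / A) *\<^sub>R \<mu>)"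
    proof -
      have "0 - y - (W / A) *\<^sub>R \<mu> = - (y + (W / A) *\<^sub>R \<mu>)" by simp
      then show ?thesis by (simp only: sym_form_minus_left[OF B(1)] sym_form_minus_right[OF B(1)] minus_minus)
    qed
    finally have T1: "T z (t + (W / A) *\<^sub>R v) = exp (- pi * B (0 - y - (W / A) *\<^sub>R \<mu>) (0 - y - (W / A) *\<^sub>R \<mu>))" .
    have T2: "T z t = exp (- pi * B (0 - y) (0 - y))"
      by (simp add: T_def dual_form_def y_def[symmetric] sym_form_simps[OF B(1)])
    have "T z t \<le> E * T z (t + (W / A) *\<^sub>R v)"
      unfolding T1 T2 E_def by (rule gaussian_tail_pointwise[OF B(1) A(1) \<mu>A W W'])
    also have "\<dots> \<le> (\<Sum>v\<in>V. E * T z (t + (W / A) *\<^sub>R v))"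
      using V v(1) by (intro member_le_sum[where f = "\<lambda>v. E * T z (t + (W / A) *\<^sub>R v)"]) (auto simp: E_def T_def)
    finally show ?thesis .
  qed
  have "primal_theta n B t \<le> (\<Sum>v\<in>V. E * primal_theta n B (t + (W / A) *\<^sub>R v))"
    using V by (intro has_sum_mono[OF hs _ pt] has_sum_finite_sum has_sum_cmult_right hs) auto
  also have "\<dots> \<le> (\<Sum>v\<in>V. E * primal_theta n B 0)"
    using ple by (intro sum_mono mult_left_mono) (auto simp: E_def)
  also have "\<dots> = card V * E * primal_theta n B 0" by simp
  finally show ?thesis by (simp add: E_def)
qed

text \<open>The division of the covariance by \<kappa> in \<open>B\<close> moves the threshold from
  - 1 to - \<kappa>. The new weights sum to 1 because the functionals of v - p average to 0 at the
  barycentre, and strict inequality at z leaves room for a ball.\<close>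

lemma interior_of_positive_combination:
  fixes V :: "(nat \<Rightarrow> real) set" and c :: "(nat \<Rightarrow> real) \<Rightarrow> real"
  defines "p \<equiv> (\<Sum>v\<in>V. c v *\<^sub>R v)"
  assumes V: "finite V" "\<And>v. v \<in> V \<Longrightarrow> in_Rd d v" and c: "\<And>v. v \<in> V \<Longrightarrow> 0 \<le> c v" "sum c V = 1"
    and \<kappa>: "\<kappa> > 0" and B_def: "B = weighted_form V (\<lambda>v. ip d (v - p)) (\<lambda>v. c v / \<kappa>)" and B: "sym_form B" "pos_def_on d B"
    and z: "in_Rd d z" "\<And>v. v \<in> V \<Longrightarrow> - \<kappa> < ip d (v - p) (riesz d B (ip d (z - p)))"
  shows "z \<in> interior_d d (conv_fin V)"
proof -
  define y where "y x = riesz d B (ip d (x - p))" for x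
  have y: "in_Rd d (y x)" "in_Rd d w \<Longrightarrow> B (y x) w = ip d (x - p) w" for x w
    unfolding y_def using in_Rd_riesz[OF B linear_ip] form_riesz[OF B linear_ip] by auto
  have p_apply: "p i = (\<Sum>v\<in>V. c v * v i)" for i
    unfolding p_def by (induction V rule: infinite_finite_induct) auto
  have mean0: "(\<Sum>v\<in>V. c v * ip d (v - p) w) = 0" for w
  proof -
    have "(\<Sum>v\<in>V. c v * ip d (v - p) w) = (\<Sum>i<d. (\<Sum>v\<in>V. c v * (v i - p i)) * w i)"
      unfolding ip_def sum_distrib_left sum_distrib_right by (subst sum.swap) (simp add: ac_simps)
    moreover have "(\<Sum>v\<in>V. c v * (v i - p i)) = 0" for i
      using c(2) by (simp add: right_diff_distrib sum_subtractf p_apply[symmetric] sum_distrib_right[symmetric])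
    ultimately show ?thesis by (simp only: mult_zero_left sum.neutral_const)
  qed
  have comb: "x \<in> conv_fin V" if x: "in_Rd d x" "\<And>v. v \<in> V \<Longrightarrow> - \<kappa> \<le> ip d (v - p) (y x)" for x
  proof -
    define u where "u v = c v * (1 + ip d (v - p) (y x) / \<kappa>)" for v
    have "0 \<le> 1 + ip d (v - p) (y x) / \<kappa>" if "v \<in> V" for v
      using x(2)[OF that] \<kappa> by (simp add: field_simps)
    then have u0: "\<forall>v\<in>V. 0 \<le> u v" using c by (simp add: u_def)
    have "sum u V = sum c V + (\<Sum>v\<in>V. c v * ip d (v - p) (y x)) / \<kappa>"
      unfolding u_def by (simp add: distrib_left sum.distrib sum_divide_distrib)
    then have u1: "sum u V = 1" using mean0 c by simp
    have "x i = (\<Sum>v\<in>V. u v * v i)" for i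
    proof (cases "i < d")
      case True
      have ei: "ip d q (unit_vec i) = q i" for q
        using True by (simp add: ip_def unit_vec_def if_distrib[of "\<lambda>a. _ * a"] cong: if_cong)
      have "x i - p i = B (y x) (unit_vec i)"
        using y(2)[OF in_Rd_unit_vec[OF True]] by (simp add: ei)
      also have "\<dots> = (\<Sum>v\<in>V. c v / \<kappa> * (ip d (v - p) (y x) * (v i - p i)))"
        by (simp add: B_def weighted_form_def ei)
      also have "\<dots> = (\<Sum>v\<in>V. c v / \<kappa> * ip d (v - p) (y x) * v i - c v * ip d (v - p) (y x) * (p i / \<kappa>))"
        using \<kappa> by (intro sum.cong refl) (simp add: field_simps)
      also have "\<dots> = (\<Sum>v\<in>V. c v / \<kappa> * ip d (v - p) (y x) * v i) - (\<Sum>v\<in>V. c v * ip d (v - p) (y x)) * (p i / \<kappa>)"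
        unfolding sum_subtractf sum_distrib_right ..
      also have "(\<Sum>v\<in>V. c v * ip d (v - p) (y x)) = 0" by (rule mean0)
      finally have "x i - p i = (\<Sum>v\<in>V. c v / \<kappa> * ip d (v - p) (y x) * v i)"
        by (simp only: mult_zero_left div_0 diff_zero)
      then have "x i = p i + (\<Sum>v\<in>V. c v / \<kappa> * ip d (v - p) (y x) * v i)"
        by (simp only: algebra_simps)
      also have "\<dots> = (\<Sum>v\<in>V. c v * v i + c v / \<kappa> * ip d (v - p) (y x) * v i)"
        unfolding p_apply[of i] sum.distrib ..
      also have "\<dots> = (\<Sum>v\<in>V. u v * v i)"
        unfolding u_def by (intro sum.cong refl) (simp add: algebra_simps)
      finally show ?thesis .
    next
      case False
      then have "d \<le> i" by simp
      then have "v i = 0" if "v \<in> V" for v using V(2)[OF that] unfolding in_Rd_def by blast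
      moreover have "x i = 0" using x(1) \<open>d \<le> i\<close> unfolding in_Rd_def by blast
      ultimately show ?thesis by (simp add: sum.neutral)
    qed
    then show ?thesis using u0 u1 unfolding conv_fin_def by blast
  qed
  define m where "m v = riesz d B (ip d (v - p))" for v
  have m: "in_Rd d (m v)" "in_Rd d w \<Longrightarrow> B (m v) w = ip d (v - p) w" for v w
    unfolding m_def using in_Rd_riesz[OF B linear_ip] form_riesz[OF B linear_ip] by auto
  \<comment> \<open>Symmetry of the inverse form: with the fixed vector \<open>m v\<close> the left
    side is visibly affine in x, so its slack at z controls nearby points.\<close>
  have Fy: "ip d (v - p) (y x) = ip d (x - p) (m v)" for v x
    using m(2)[OF y(1)] y(2)[OF m(1)] sym_form_commute[OF B(1)] by metis
  \<comment> \<open>Slack of the constraint divided by a bound for the slope of the functional; the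
    added 1 keeps the denominator positive.\<close>
  define r where "r v = (ip d (v - p) (y z) + \<kappa>) / (1 + (\<Sum>i<d. \<bar>m v i\<bar>))" for v
  have den: "1 + (\<Sum>i<d. \<bar>m v i\<bar>) > 0" for v by (intro add_pos_nonneg sum_nonneg) auto
  have rpos: "r v > 0" if "v \<in> V" for v
    unfolding r_def using z(2)[OF that, folded y_def] den by (intro divide_pos_pos) auto
  define e where "e = Min (insert 1 (r ` V))"
  have e: "e > 0" "\<And>v. v \<in> V \<Longrightarrow> e \<le> r v" unfolding e_def using V rpos by (auto simp: Min_gr_iff)
  show ?thesis
    unfolding interior_d_def
  proof (intro CollectI conjI z(1) exI[of _ e] e(1) allI impI)
    fix x assume x: "in_Rd d x \<and> dist_d d z x < e"
    show "x \<in> conv_fin V"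
    proof (rule comb)
      fix v assume v: "v \<in> V"
      have coord: "\<bar>x i - z i\<bar> \<le> e" if "i < d" for i
      proof -
        have "(x i - z i)\<^sup>2 \<le> (\<Sum>i<d. (z i - x i)\<^sup>2)"
          using that member_le_sum[of i "{..<d}" "\<lambda>i. (z i - x i)\<^sup>2"] by (simp add: power2_commute)
        then have "\<bar>x i - z i\<bar> \<le> dist_d d z x" 
          unfolding dist_d_def by (metis real_sqrt_le_iff real_sqrt_abs)
        then show ?thesis using x by simp
      qed
      have "\<bar>ip d (x - z) (m v)\<bar> \<le> (\<Sum>i<d. \<bar>(x i - z i) * m v i\<bar>)"
        unfolding ip_def by (simp add: sum_abs)
      also have "\<dots> \<le> (\<Sum>i<d. e * \<bar>m v i\<bar>)"
        unfolding abs_mult using coord by (intro sum_mono mult_right_mono) auto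
      also have "\<dots> \<le> e * (1 + (\<Sum>i<d. \<bar>m v i\<bar>))"
        using e(1) by (simp add: sum_distrib_left[symmetric] distrib_left)
      also have "\<dots> \<le> r v * (1 + (\<Sum>i<d. \<bar>m v i\<bar>))"
        using e(2)[OF v] den[of v] by (intro mult_right_mono) auto
      also have "\<dots> = ip d (v - p) (y z) + \<kappa>"
        unfolding r_def using den[of v] by simp
      finally have "- (ip d (v - p) (y z) + \<kappa>) \<le> ip d (x - z) (m v)" by simp
      also have "ip d (x - z) (m v) = ip d (v - p) (y x) - ip d (v - p) (y z)"
        unfolding Fy by (simp add: ip_simps)
      finally show "- \<kappa> \<le> ip d (v - p) (y x)" by simp
    qed (use x in auto)
  qed
qed

subsection \<open>Flatness\<close>

lemma flatness_few_vertices: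
  fixes V :: "(nat \<Rightarrow> real) set"
  assumes d: "d \<ge> 1" and V: "finite V" "\<And>v. v \<in> V \<Longrightarrow> in_Rd d v"
    and full: "\<And>a b. \<exists>i<d. a i \<noteq> 0 \<Longrightarrow> \<not> V \<subseteq> hyperplane_d d a b"
    and hollow: "\<And>z. lattice_pt d z \<Longrightarrow> z \<notin> interior_d d (conv_fin V)"
  shows "\<exists>w q. lattice_pt d w \<and> w \<noteq> 0 \<and>
    (\<forall>v\<in>V. \<bar>ip d v w - q\<bar> < 5 * real (d + 1) * ln (8 * real (card V)))"
proof -
  \<comment> \<open>Points are lifted to height 1 in R^(d+1), where second moments are linear in the
    weights. The vector \<open>lift w\<close> below is chosen to vanish on the lifted barycentre,
    and there \<open>f v\<close> becomes the centred functional \<open>F v\<close>, second moments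
    becoming covariance.\<close>
  define f where "f v w = ip d v w + w d" for v w :: "nat \<Rightarrow> real"
  have lin: "linear (f v)" for v
    by (rule linearI) (simp_all add: f_def ip_simps algebra_simps)
  have "\<exists>i<d. unit_vec 0 i \<noteq> 0" using d by (auto simp: unit_vec_def)
  then have Vne: "V \<noteq> {}" using full[of "unit_vec 0" 0] by auto
  have sep: "\<exists>v\<in>V. f v w \<noteq> 0" if w: "in_Rd (Suc d) w" "w \<noteq> 0" for w
  proof (rule ccontr)
    assume "\<not> ?thesis"
    then have z: "ip d v w = - w d" if "v \<in> V" for v using that by (auto simp: f_def add_eq_0_iff2)
    have "V \<subseteq> hyperplane_d d w (- w d)"
      using z V(2) by (auto simp: hyperplane_d_def ip_def mult.commute)
    then have w0: "w i = 0" if "i < d" for i using full[of w "- w d"] that by blast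
    obtain v where v: "v \<in> V" using Vne by blast
    have "ip d v w = 0" unfolding ip_def using w0 by simp
    then have "w d = 0" using z[OF v] by simp
    then have "w i = 0" for i
      using w0[of i] w(1) by (cases "i < d"; cases "i = d") (auto simp: in_Rd_def)
    then show False using w(2) by (auto simp: fun_eq_iff)
  qed
  obtain c where c: "\<And>v. v \<in> V \<Longrightarrow> 0 \<le> c v" "sum c V = 1" and pdh: "pos_def_on (Suc d) (weighted_form V f c)"
    and des: "\<And>v w. v \<in> V \<Longrightarrow> in_Rd (Suc d) w \<Longrightarrow> (f v w)\<^sup>2 \<le> 5 * real (Suc d) * weighted_form V f c w w"
    using optimal_design[OF V(1), of f "Suc d"] lin sep by auto
  define K where "K = 5 * real (d + 1)"
  define L where "L = ln (8 * real (card V))"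
  have N: "card V \<ge> 1" using V(1) Vne by (simp add: Suc_le_eq card_gt_0_iff)
  have L: "L > 0" unfolding L_def using N by simp
  have K: "K > 0" by (simp add: K_def)
  \<comment> \<open>Used both as the scale of \<open>B\<close> and as the threshold of the half
    spaces. With A = K \<kappa> this gives \<kappa>^2 / A = L, so each tail factor is at most exp (-
    L), which is 1 / (8 N) for N vertices.\<close>
  define \<kappa> where "\<kappa> = K * L"
  have \<kappa>: "\<kappa> > 0" using K L by (simp add: \<kappa>_def)
  define p where "p = (\<Sum>v\<in>V. c v *\<^sub>R v)"
  define F where "F = (\<lambda>v. ip d (v - p))"
  define B where "B = weighted_form V F (\<lambda>v. c v / \<kappa>)"
  have linF: "linear (F v)" for v by (simp add: F_def linear_ip)
  have B: "sym_form B" unfolding B_def by (rule sym_form_weighted_form[OF linF])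
  define lift where "lift w = w + (- ip d p w) *\<^sub>R unit_vec d" for w
  have lift: "in_Rd (Suc d) (lift w)" if "in_Rd d w" for w
    using that by (auto simp: lift_def)
  have flift: "f v (lift w) = F v w" if w: "in_Rd d w" for v w
  proof -
    have "ip d v (unit_vec d) = 0" by (simp add: ip_def unit_vec_def)
    moreover have "w d = 0" using w by (simp add: in_Rd_def)
    ultimately show ?thesis by (simp add: f_def F_def lift_def ip_simps unit_vec_def)
  qed
  have BB: "weighted_form V f c (lift w) (lift w) = \<kappa> * B w w" if w: "in_Rd d w" for w
    unfolding B_def weighted_form_def flift[OF w] sum_distrib_left using \<kappa> by (intro sum.cong) auto
  have pd: "pos_def_on d B"
    unfolding pos_def_on_def
  proof (intro allI impI)
    fix w assume w: "in_Rd d w" "w \<noteq> 0"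
    have "lift w \<noteq> 0"
    proof
      assume "lift w = 0"
      then have l: "lift w i = 0" for i by simp
      have "w i = 0" for i
        using l[of i] w(1) by (cases "i < d") (auto simp: lift_def unit_vec_def in_Rd_def)
      then show False using w(2) by (auto simp: fun_eq_iff)
    qed
    then have "0 < \<kappa> * B w w" using pdh lift[OF w(1)] BB[OF w(1)] by (auto simp: pos_def_on_def)
    then show "0 < B w w" using \<kappa> by (simp add: zero_less_mult_iff)
  qed
  define A where "A = K * \<kappa>"
  have A: "A > 0" using K \<kappa> by (simp add: A_def)
  \<comment> \<open>The design inequality tested at the Riesz vector of \<open>F v\<close> itself
    reads a^2 \<le> A a.\<close>
  have dual: "dual_form d B (F v) \<le> A" if v: "v \<in> V" for v
  proof -
    define a where "a = dual_form d B (F v)"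
    define \<eta> where "\<eta> = riesz d B (F v)"
    have \<eta>: "in_Rd d \<eta>" unfolding \<eta>_def by (rule in_Rd_riesz[OF B pd linF])
    have Ba: "B \<eta> \<eta> = a" by (simp add: a_def dual_form_def \<eta>_def)
    have "F v \<eta> = a" using form_riesz[OF B pd linF \<eta>, of v] Ba by (simp add: \<eta>_def)
    then have "a\<^sup>2 \<le> A * a"
      using des[OF v lift[OF \<eta>]] unfolding flift[OF \<eta>] BB[OF \<eta>] Ba by (simp add: A_def K_def algebra_simps)
    then show ?thesis unfolding a_def[symmetric]
      using A by (cases "a > 0") (auto simp: power2_eq_square)
  qed
  have WA: "\<kappa>\<^sup>2 / A = L" using K L by (simp add: A_def \<kappa>_def power2_eq_square)
  have E: "exp (- pi * \<kappa>\<^sup>2 / A) \<le> 1 / (8 * real (card V))"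
  proof -
    have "- pi * \<kappa>\<^sup>2 / A = - pi * L" using WA by (metis times_divide_eq_right)
    also have "\<dots> \<le> - L" using mult_right_mono[of 1 pi L] pi_ge_two L by simp
    finally have "exp (- pi * \<kappa>\<^sup>2 / A) \<le> exp (- L)" by simp
    moreover have "0 < 8 * real (card V)" using N by simp
    then have "exp (- L) = 1 / (8 * real (card V))" unfolding L_def by (simp only: exp_minus exp_ln inverse_eq_divide)
    ultimately show ?thesis by simp
  qed
  obtain C where C: "C > 0" "primal_theta d B 0 = C * dual_theta d B 0"
      "\<And>t. C * (2 - dual_theta d B 0) \<le> primal_theta d B t"
    using theta_duality[OF B pd] by metis
  have nn: "dual_theta d B 0 \<ge> 0" unfolding dual_theta_def by (intro infsum_nonneg) simp
  have pnn: "primal_theta d B 0 \<ge> 0" using C nn by simp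

  \<comment> \<open>With \<Theta> the unshifted dual sum: without such a w, the first union bound
    gives \<Theta> \<le> 1 + \<Theta> / 4, so \<Theta> \<le> 4/3. If moreover every lattice point
    violated some constraint, the second would give 2 - \<Theta> \<le> \<Theta> / 8, so \<Theta>
    \<ge> 16/9.\<close>
  have "\<exists>w. lattice_pt d w \<and> w \<noteq> 0 \<and> (\<forall>v\<in>V. \<bar>F v w\<bar> < \<kappa>)"
  proof (rule ccontr)
    assume neg: "\<not> ?thesis"
    have "dual_theta d B 0 \<le> 1 + 2 * card V * exp (- pi * \<kappa>\<^sup>2 / A) * dual_theta d B 0"
      using neg \<kappa> by (intro dual_theta_le_of_cover[OF B pd V(1) linF A dual]) (auto simp: not_less)
    also have "\<dots> \<le> 1 + 2 * card V * (1 / (8 * real (card V))) * dual_theta d B 0"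
      using E nn by (intro add_left_mono mult_right_mono mult_left_mono) auto
    also have "\<dots> = 1 + dual_theta d B 0 / 4" using N by simp
    finally have th: "dual_theta d B 0 \<le> 4 / 3" by simp
    have "\<exists>z. lattice_pt d z \<and> (\<forall>v\<in>V. - \<kappa> < F v (riesz d B (ip d (z - p))))"
    proof (rule ccontr)
      assume neg2: "\<not> ?thesis"
      let ?V = "(\<lambda>v. v - p) ` V"
      have cV: "card ?V = card V" by (rule card_image) (auto simp: inj_on_def)
      have "primal_theta d B (- p) \<le> card ?V * exp (- pi * \<kappa>\<^sup>2 / A) * primal_theta d B 0"
      proof (rule primal_theta_le_of_cover[OF B pd _ A])
        show "finite ?V" using V by simp
        show "dual_form d B (ip d v) \<le> A" if "v \<in> ?V" for v using that dual by (auto simp: F_def)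
        show "\<exists>v\<in>?V. ip d v (riesz d B (ip d (z + - p))) \<le> - \<kappa>" if "z \<in> lattice d" for z
        proof -
          have "lattice_pt d z" using that by simp
          then obtain v where v: "v \<in> V" "\<not> - \<kappa> < F v (riesz d B (ip d (z - p)))" using neg2 by blast
          have "ip d (v - p) (riesz d B (ip d (z + - p))) \<le> - \<kappa>"
            using v(2) unfolding F_def add_uminus_conv_diff by (simp only: not_less)
          then show ?thesis using v(1) by blast
        qed
      qed (use \<kappa> in auto)
      also have "\<dots> \<le> card V * (1 / (8 * real (card V))) * primal_theta d B 0"
        unfolding cV using E pnn by (intro mult_right_mono mult_left_mono) auto
      also have "\<dots> = C * dual_theta d B 0 / 8" using N C(2) by simp
      finally have "C * (2 - dual_theta d B 0) \<le> C * (dual_theta d B 0 / 8)" using C(3)[of "- p"] by simp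
      then have "2 - dual_theta d B 0 \<le> dual_theta d B 0 / 8" using C(1) by simp
      then show False using th by simp
    qed
    then obtain z where z: "lattice_pt d z" "\<And>v. v \<in> V \<Longrightarrow> - \<kappa> < F v (riesz d B (ip d (z - p)))" by blast
    have "z \<in> interior_d d (conv_fin V)"
      by (rule interior_of_positive_combination[OF V c \<kappa> B_def[unfolded F_def p_def] B pd])
        (use z in \<open>auto simp: lattice_pt_def F_def p_def\<close>)
    then show False using hollow[OF z(1)] by simp
  qed
  then obtain w where w: "lattice_pt d w" "w \<noteq> 0" "\<And>v. v \<in> V \<Longrightarrow> \<bar>F v w\<bar> < \<kappa>" by blast
  show ?thesis
  proof (intro exI[of _ w] exI[of _ "ip d p w"] conjI w(1,2) ballI)
    show "\<bar>ip d v w - ip d p w\<bar> < 5 * real (d + 1) * ln (8 * real (card V))" if "v \<in> V" for v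
      using w(3)[OF that] unfolding F_def ip_diff_left \<kappa>_def K_def L_def .
  qed
qed

section \<open>Vertices of a finite hull, lattice levels and the final count\<close>

lemma vertices_conv_fin_subset:
  assumes V: "finite V"
  shows "vertices (conv_fin V) \<subseteq> V"
proof
  fix x assume x: "x \<in> vertices (conv_fin V)"
  then obtain u where u: "\<And>v. v \<in> V \<Longrightarrow> 0 \<le> u v" "sum u V = 1" "x = (\<lambda>i. \<Sum>v\<in>V. u v * v i)"
    unfolding vertices_def conv_fin_def by blast
  obtain a where a: "a \<in> V" "u a > 0"
  proof -
    have "\<exists>a\<in>V. u a \<noteq> 0" using u(2) by (metis sum.neutral zero_neq_one)
    then show ?thesis using u(1) that by (metis less_eq_real_def)
  qed
  have split: "sum g V = g a + sum g (V - {a})" for g :: "(nat \<Rightarrow> real) \<Rightarrow> real"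
    using V a by (simp add: sum.remove)
  show "x \<in> V"
  proof (cases "u a = 1")
    case True
    then have "sum u (V - {a}) = 0" using split[of u] u(2) by simp
    then have "\<forall>v\<in>V - {a}. u v = 0" using V u(1) by (subst (asm) sum_nonneg_eq_0_iff) auto
    then have "x i = a i" for i unfolding u(3) split[of "\<lambda>v. u v * v i"] using True by simp
    then show ?thesis using a by (metis ext)
  next
    case False
    have "u a \<le> 1" using member_le_sum[of a V u] a u V by auto
    then have t: "0 < u a" "u a < 1" using a False by auto
    \<comment> \<open>The weights other than that of \<open>a\<close>, renormalised: x lies strictly
      between \<open>a\<close> and \<open>b\<close>, so a vertex forces \<open>b\<close> =
      \<open>a\<close>.\<close>
    define b where "b = (\<lambda>i. \<Sum>v\<in>V. (if v = a then 0 else u v / (1 - u a)) * v i)"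
    have b: "b \<in> conv_fin V"
    proof -
      have "(\<Sum>v\<in>V. if v = a then 0 else u v / (1 - u a)) = sum u (V - {a}) / (1 - u a)"
        unfolding split[of "\<lambda>v. if v = a then 0 else u v / (1 - u a)"] sum_divide_distrib by (auto intro!: sum.cong)
      also have "\<dots> = 1" using split[of u] u(2) t by simp
      finally show ?thesis
        unfolding conv_fin_def b_def using u(1) t
        by (intro CollectI exI[of _ "\<lambda>v. if v = a then 0 else u v / (1 - u a)"]) auto
    qed
    have a': "a \<in> conv_fin V"
      unfolding conv_fin_def using V a
      by (intro CollectI exI[of _ "\<lambda>v. if v = a then 1 else 0"]) (auto simp: if_distrib[of "\<lambda>r. r * _"] cong: if_cong)
    have comb: "x = (\<lambda>i. (1 - u a) * b i + u a * a i)"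
    proof
      fix i
      have "(1 - u a) * b i = (\<Sum>v\<in>V - {a}. u v * v i)"
        unfolding b_def split[of "\<lambda>v. (if v = a then 0 else u v / (1 - u a)) * v i"] distrib_left sum_distrib_left
        using t by (auto intro!: sum.cong)
      then show "x i = (1 - u a) * b i + u a * a i"
        unfolding u(3) split[of "\<lambda>v. u v * v i"] by simp
    qed
    have "b = a" using x t b a' comb unfolding vertices_def by blast
    then have "x = a" unfolding comb by (auto simp: algebra_simps)
    then show ?thesis using a by simp
  qed
qed

lemma conv_fin_mono:
  assumes "S \<subseteq> V" "finite V"
  shows "conv_fin S \<subseteq> conv_fin V"
proof
  fix x assume "x \<in> conv_fin S"
  then obtain u where u: "\<forall>v\<in>S. 0 \<le> u v" "sum u S = 1" "x = (\<lambda>i. \<Sum>v\<in>S. u v * v i)"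
    by (auto simp: conv_fin_def)
  let ?u = "\<lambda>v. if v \<in> S then u v else 0"
  have "sum ?u V = 1"
    unfolding u(2)[symmetric] using assms by (intro sum.mono_neutral_cong_right) auto
  moreover have "(\<Sum>v\<in>V. ?u v * v i) = (\<Sum>v\<in>S. u v * v i)" for i
    using assms by (intro sum.mono_neutral_cong_right) auto
  ultimately show "x \<in> conv_fin V"
    unfolding conv_fin_def using u by (intro CollectI exI[of _ ?u]) auto
qed

lemma interior_d_mono: "S \<subseteq> T \<Longrightarrow> interior_d d S \<subseteq> interior_d d T"
  unfolding interior_d_def by blast

lemma card_le_fibres:
  assumes "finite S" "\<And>k. card {v \<in> S. g v = k} \<le> m"
  shows "card S \<le> card (g ` S) * m"
proof -
  have "S = (\<Union>k\<in>g ` S. {v \<in> S. g v = k})" by auto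
  then have "card S \<le> (\<Sum>k\<in>g ` S. card {v \<in> S. g v = k})"
    using card_UN_le[of "g ` S" "\<lambda>k. {v \<in> S. g v = k}"] assms(1) by auto
  also have "\<dots> \<le> (\<Sum>k\<in>g ` S. m)" using assms(2) by (intro sum_mono)
  finally show ?thesis by simp
qed

lemma card_Ints_le:
  fixes S :: "real set"
  assumes "S \<subseteq> \<int>" "\<And>x. x \<in> S \<Longrightarrow> \<bar>x - q\<bar> < W" "W \<ge> 0"
  shows "real (card S) \<le> 2 * W + 1"
proof -
  have "S \<subseteq> of_int ` {\<lceil>q - W\<rceil>..\<lfloor>q + W\<rfloor>}"
  proof
    fix x assume x: "x \<in> S"
    then obtain k where k: "x = of_int k" using assms(1) by (auto elim: Ints_cases)
    have "\<bar>of_int k - q\<bar> < W" using assms(2)[OF x] k by simp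
    then have "\<lceil>q - W\<rceil> \<le> k" "k \<le> \<lfloor>q + W\<rfloor>" by (auto simp: ceiling_le_iff le_floor_iff)
    then show "x \<in> of_int ` {\<lceil>q - W\<rceil>..\<lfloor>q + W\<rfloor>}" using k by auto
  qed
  then have "card S \<le> card {\<lceil>q - W\<rceil>..\<lfloor>q + W\<rfloor>}"
    by (meson card_image_le card_mono finite_atLeastAtMost_int finite_imageI order_trans)
  also have "\<dots> = nat (\<lfloor>q + W\<rfloor> - \<lceil>q - W\<rceil> + 1)" by simp
  finally have "real (card S) \<le> real (nat (\<lfloor>q + W\<rfloor> - \<lceil>q - W\<rceil> + 1))" by simp
  also have "\<dots> \<le> 2 * W + 1"
  proof -
    have "real (nat (a - b + 1)) \<le> 2 * W + 1" if "real_of_int a \<le> q + W" "q - W \<le> real_of_int b" for a b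
      using that assms(3) by (cases "a - b + 1 \<ge> 0") simp_all
    from this[OF of_int_floor_le le_of_int_ceiling] show ?thesis .
  qed
  finally show ?thesis .
qed

text \<open>Bootstrapping: with x = 8 N, the crude ln x \<le> 2 sqrt x gives x \<le> 2^16 d^4 \<le>
  d^20, hence ln x \<le> 20 ln d, and a second use of the hypothesis gives N \<le> 320 d^2 ln d. The
  cube of the logarithm is reached only by weakening, through ln d \<ge> 2/3.\<close>

lemma self_bounding_log:
  fixes N d :: nat
  assumes d: "d \<ge> 2" and N: "N \<ge> 1"
    and le: "real N \<le> real d * (2 * (5 * real (d + 1) * ln (8 * real N)) + 1)"
  shows "real N \<le> 1000 * real d ^ 2 * ln (real d) ^ 3"
proof -
  define x where "x = 8 * real N"
  have x: "x \<ge> 8" using N by (simp add: x_def)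
  have ln2: "ln (2::real) \<ge> 2/3" by (rule ln2_ge_two_thirds)
  have ln8: "ln x \<ge> 2"
  proof -
    have "ln (8::real) = 3 * ln 2" using ln_realpow[of 2 3] by simp
    moreover have "ln 8 \<le> ln x" using x by simp
    ultimately show ?thesis using ln2 by simp
  qed
  have d': "real d \<ge> 2" using d by simp
  have b1: "real N \<le> 16 * real d ^ 2 * ln x"
  proof -
    have "2 * (5 * real (d + 1) * ln x) + 1 \<le> 15 * real d * ln x + real d * ln x / 2"
    proof -
      have "10 * real (d + 1) \<le> 15 * real d" using d' by simp
      then have "10 * real (d + 1) * ln x \<le> 15 * real d * ln x" using ln8 by (intro mult_right_mono) auto
      moreover have "2 * 2 \<le> real d * ln x" using d' ln8 by (intro mult_mono) auto
      moreover have "2 * (5 * real (d + 1) * ln x) = 10 * real (d + 1) * ln x" by simp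
      ultimately show ?thesis by linarith
    qed
    also have "\<dots> \<le> 16 * real d * ln x" using d' ln8 by simp
    finally have "real d * (2 * (5 * real (d + 1) * ln x) + 1) \<le> real d * (16 * real d * ln x)"
      using d' by (intro mult_left_mono) auto
    then show ?thesis using le by (simp add: x_def power2_eq_square algebra_simps)
  qed
  have lnx: "ln x \<le> 2 * sqrt x"
  proof -
    have "ln (sqrt x) \<le> sqrt x" using ln_le_minus_one[of "sqrt x"] x by simp
    then show ?thesis using x by (simp add: ln_sqrt)
  qed
  have "x \<le> 128 * real d ^ 2 * (2 * sqrt x)"
    using b1 mult_left_mono[OF lnx, of "128 * real d ^ 2"] by (simp add: x_def)
  then have "sqrt x * sqrt x \<le> 256 * real d ^ 2 * sqrt x" using x by simp
  moreover have "sqrt x > 0" using x by simp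
  ultimately have "sqrt x \<le> 256 * real d ^ 2" by (rule mult_right_le_imp_le)
  then have "(sqrt x)\<^sup>2 \<le> (256 * real d ^ 2)\<^sup>2" using x by (intro power_mono) auto
  then have "x \<le> 2 ^ 16 * real d ^ 4" using x by (simp add: power_mult_distrib flip: power_mult)
  also have "\<dots> \<le> real d ^ 16 * real d ^ 4" using d' by (intro mult_right_mono power_mono) auto
  also have "\<dots> = real d ^ 20" by (simp flip: power_add)
  finally have "ln x \<le> ln (real d ^ 20)" using x d by (subst ln_le_cancel_iff) auto
  also have "\<dots> = 20 * ln (real d)" using d' by (simp add: ln_realpow)
  finally have "16 * real d ^ 2 * ln x \<le> 16 * real d ^ 2 * (20 * ln (real d))" by (intro mult_left_mono) auto
  with b1 have "real N \<le> 16 * real d ^ 2 * (20 * ln (real d))" by (rule order_trans)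
  also have "\<dots> = 320 * real d ^ 2 * ln (real d)" by simp
  also have "\<dots> \<le> 1000 * real d ^ 2 * ln (real d) ^ 3"
  proof -
    have "ln 2 \<le> ln (real d)" using d' by simp
    then have "ln (real d) \<ge> 2/3" using ln2 by linarith
    then have "(2/3)\<^sup>2 \<le> ln (real d) ^ 2" by (intro power_mono) auto
    then have "320 \<le> 1000 * ln (real d) ^ 2" by (simp add: power2_eq_square)
    then have "320 * (real d ^ 2 * ln (real d)) \<le> 1000 * ln (real d) ^ 2 * (real d ^ 2 * ln (real d))"
      using \<open>ln (real d) \<ge> 2/3\<close> by (intro mult_right_mono) auto
    then show ?thesis by (simp add: power2_eq_square power3_eq_cube algebra_simps)
  qed
  finally show ?thesis .
qed

theorem theorem15:
  shows "\<exists>C>0. \<forall>d::nat. d \<ge> 2 \<longrightarrow>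
     (\<forall>V P. finite V \<and> (\<forall>v\<in>V. lattice_pt d v) \<and> P = conv_fin V \<and>
        (\<forall>z. lattice_pt d z \<longrightarrow> z \<notin> interior_d d P) \<and>
        general_position d (vertices P)
        \<longrightarrow> real (card (vertices P)) \<le> C * real d ^ 2 * ln (real d) ^ 3)"
proof (intro exI[of _ 1000] conjI allI impI)
  \<comment> \<open>The constant has slack: with ln d \<ge> 2/3 it has to satisfy 1000 (2/3)^2 \<ge>
    320 for many vertices and 1000 (2/3)^3 \<ge> 1 for at most d of them.\<close>
  show "(0::real) < 1000" by simp
  fix d :: nat and V P :: "(nat \<Rightarrow> real) set"
  assume d: "2 \<le> d" and H: "finite V \<and> (\<forall>v\<in>V. lattice_pt d v) \<and> P = conv_fin V \<and>
        (\<forall>z. lattice_pt d z \<longrightarrow> z \<notin> interior_d d P) \<and> general_position d (vertices P)"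
  \<comment> \<open>The width bound is applied to the hull of the vertices, not to that of
    \<open>V\<close>. This hull lies in \<open>P\<close>, so it is hollow as well; equality with
    \<open>P\<close> need not be known.\<close>
  define S where "S = vertices P"
  have SV: "S \<subseteq> V" using H vertices_conv_fin_subset by (auto simp: S_def)
  have S: "finite S" using SV H finite_subset by blast
  have Slat: "lattice_pt d v" if "v \<in> S" for v using that SV H by blast
  have gp: "card {v \<in> S. v \<in> hyperplane_d d a b} \<le> d" if a: "\<exists>i<d. a i \<noteq> 0" for a b
  proof (rule ccontr)
    assume "\<not> ?thesis"
    then have "d + 1 \<le> card {v \<in> S. v \<in> hyperplane_d d a b}" by simp
    then obtain T where T: "T \<subseteq> {v \<in> S. v \<in> hyperplane_d d a b}" "card T = d + 1"
      by (rule obtain_subset_with_card_n)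
    then have "T \<subseteq> vertices P" "T \<subseteq> hyperplane_d d a b" by (auto simp: S_def)
    moreover have "\<not> (\<exists>a b. (\<exists>i<d. a i \<noteq> 0) \<and> T \<subseteq> hyperplane_d d a b)"
      using H T(2) \<open>T \<subseteq> vertices P\<close> unfolding general_position_def by simp
    ultimately show False using a by blast
  qed
  show "real (card (vertices P)) \<le> 1000 * real d ^ 2 * ln (real d) ^ 3"
    unfolding S_def[symmetric]
  proof (cases "card S \<ge> d + 1")
    case True
    \<comment> \<open>More than d vertices in general position cannot share a hyperplane, which is
      the full-dimensionality that the covariance form needs to be definite.\<close>
    have full: "\<not> S \<subseteq> hyperplane_d d a b" if "\<exists>i<d. a i \<noteq> 0" for a b
    proof
      assume "S \<subseteq> hyperplane_d d a b"
      then have "{v \<in> S. v \<in> hyperplane_d d a b} = S" by auto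
      then show False using gp[OF that, of b] True by simp
    qed
    have "conv_fin S \<subseteq> P" using conv_fin_mono[OF SV] H by simp
    then have hollow: "z \<notin> interior_d d (conv_fin S)" if "lattice_pt d z" for z
      using interior_d_mono H that by blast
    have d1: "d \<ge> 1" using d by simp
    have SRd: "in_Rd d v" if "v \<in> S" for v using Slat[OF that] by (simp add: lattice_pt_def)
    obtain w q where w: "lattice_pt d w" "w \<noteq> 0"
        "\<And>v. v \<in> S \<Longrightarrow> \<bar>ip d v w - q\<bar> < 5 * real (d + 1) * ln (8 * real (card S))"
      using flatness_few_vertices[OF d1 S SRd full hollow] by blast
    define g where "g v = ip d v w" for v
    have "\<exists>i<d. w i \<noteq> 0"
    proof (rule ccontr)
      assume "\<not> ?thesis"
      then have "w i = 0" for i using w(1) by (cases "i < d") (auto simp: lattice_pt_def in_Rd_def)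
      then show False using w(2) by (auto simp: fun_eq_iff)
    qed
    then have "card {v \<in> S. v \<in> hyperplane_d d w k} \<le> d" for k by (rule gp)
    moreover have "{v \<in> S. v \<in> hyperplane_d d w k} = {v \<in> S. g v = k}" for k
      using SRd by (auto simp: hyperplane_d_def g_def ip_def mult.commute)
    ultimately have "card S \<le> card (g ` S) * d" by (intro card_le_fibres[OF S]) simp
    then have "real (card S) \<le> real (card (g ` S)) * real d" by (simp flip: of_nat_mult)
    also have "real (card (g ` S)) \<le> 2 * (5 * real (d + 1) * ln (8 * real (card S))) + 1"
    proof (rule card_Ints_le)
      show "g ` S \<subseteq> \<int>"
        using Slat w(1) by (auto simp: g_def ip_def lattice_pt_def)
      show "\<bar>x - q\<bar> < 5 * real (d + 1) * ln (8 * real (card S))" if "x \<in> g ` S" for x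
        using that w(3) by (auto simp: g_def)
      show "0 \<le> 5 * real (d + 1) * ln (8 * real (card S))" using True by simp
    qed
    finally show "real (card S) \<le> 1000 * real d ^ 2 * ln (real d) ^ 3"
      using d True by (intro self_bounding_log) (auto simp: mult.commute mult_right_mono)
  next
    case False
    have "ln 2 \<le> ln (real d)" using d by simp
    then have ln2: "ln (real d) \<ge> 2/3" using ln2_ge_two_thirds by linarith
    have "1 \<le> 1000 * (2/3 :: real) ^ 3" by (simp add: power3_eq_cube)
    also have "\<dots> \<le> 1000 * ln (real d) ^ 3" using ln2 by (intro mult_left_mono power_mono) auto
    finally have l: "1 \<le> 1000 * ln (real d) ^ 3" .
    have "real (card S) \<le> real d" using False by simp
    also have "\<dots> \<le> real d ^ 2" using d by (simp add: power2_eq_square)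
    also have "\<dots> \<le> real d ^ 2 * (1000 * ln (real d) ^ 3)"
      using mult_left_mono[OF l, of "real d ^ 2"] by simp
    finally show "real (card S) \<le> 1000 * real d ^ 2 * ln (real d) ^ 3" by (simp add: ac_simps)
  qed
qed

end
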